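(* Let $k \geq 5$ and $n \geq 2(k-1)$ be integers. Then each of the groups $\mathrm{Aut}^+(F_n)$, $\mathrm{Out}^+(F_n)$ and $\mathrm{SL}(n,\mathbb{Z})$ is generated by eight elements of order $k$. When $k \geq 6$ and $n \geq 2k$, seven elements of order $k$ suffice to generate each of these groups.
   Context: $F_n$ is the free group of rank $n$, $\mathrm{Aut}(F_n)$ its automorphism group, and $\mathrm{Out}(F_n) = \mathrm{Aut}(F_n)/\mathrm{Inn}(F_n)$ its outer automorphism group. The action on the abelianization $\mathbb{Z}^n$ of $F_n$ gives surjections $\mathrm{Aut}(F_n)\to \mathrm{GL}(n,\mathbb{Z})$ and $\mathrm{Out}(F_n)\to \mathrm{GL}(n,\mathbb{Z})$. The special automorphism group $\mathrm{Aut}^+(F_n)$ and the special outer automorphism group $\mathrm{Out}^+(F_n)$ are the preimages of $\mathrm{SL}(n,\mathbb{Z})$ under these maps; they are index 2 subgroups of $\mathrm{Aut}(F_n)$ and $\mathrm{Out}(F_n)$ respectively. "Generated by $m$ elements of order $k$" (or "$m$ elements of order $k$ suffice") means that there is a generating set consisting of at most $m$ elements, each of order exactly $k$. *)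

theory Defs
  imports
    "HOL-Algebra.Multiplicative_Group"
    "HOL-Algebra.Generated_Groups"
    "HOL-Algebra.Group_Action"
    "Jordan_Normal_Form.Determinant"
begin

section \<open>Free groups\<close>

text \<open>The letter \<open>(x, True)\<close> stands for the generator \<open>x\<close> and \<open>(x, False)\<close> for its inverse.
  Elements of the free group are the reduced words, and the product of two reduced words is
  the reduced form of their concatenation.\<close>

definition inv_letter :: "'a \<times> bool \<Rightarrow> 'a \<times> bool" where
  "inv_letter x = (fst x, \<not> snd x)"

definition reduced :: "('a \<times> bool) list \<Rightarrow> bool" where
  "reduced w \<longleftrightarrow> successively (\<lambda>x y. y \<noteq> inv_letter x) w"

fun push :: "'a \<times> bool \<Rightarrow> ('a \<times> bool) list \<Rightarrow> ('a \<times> bool) list" where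
  "push x [] = [x]"
| "push x (y # w) = (if y = inv_letter x then w else x # y # w)"

definition free_group :: "'a set \<Rightarrow> ('a \<times> bool) list monoid" where
  "free_group S =
     \<lparr>carrier = {w. reduced w \<and> fst ` set w \<subseteq> S},
      monoid.mult = (\<lambda>u v. foldr push u v),
      one = []\<rparr>"

abbreviation Fn :: "nat \<Rightarrow> (nat \<times> bool) list monoid" where
  "Fn n \<equiv> free_group {..<n}"

definition gen :: "'a \<Rightarrow> ('a \<times> bool) list" where
  "gen x = [(x, True)]"

lemma inv_letter_invol [simp]: "inv_letter (inv_letter x) = x"
  by (simp add: inv_letter_def)

lemma fst_inv_letter [simp]: "fst (inv_letter x) = fst x"
  by (simp add: inv_letter_def)

lemma inv_letter_neq [simp]: "inv_letter x \<noteq> x" "x \<noteq> inv_letter x"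
  by (auto simp: inv_letter_def prod_eq_iff)

lemma reduced_Nil [simp]: "reduced []"
  by (simp add: reduced_def)

lemma reduced_ConsD: "reduced (x # w) \<Longrightarrow> reduced w"
  by (cases w) (auto simp: reduced_def)

lemma reduced_push [simp]: "reduced w \<Longrightarrow> reduced (push x w)"
  by (cases w) (auto simp: reduced_def successively_Cons)

lemma push_reduced_Cons: "reduced (x # w) \<Longrightarrow> push x w = x # w"
  by (cases w) (auto simp: reduced_def)

lemma push_push_inv: "reduced w \<Longrightarrow> push x (push (inv_letter x) w) = w"
  by (cases w) (auto simp: push_reduced_Cons)

lemma push_inv_push: "reduced w \<Longrightarrow> push (inv_letter x) (push x w) = w"
  using push_push_inv[of w "inv_letter x"] by simp

lemma set_push: "set (push x w) \<subseteq> insert x (set w)"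
  by (cases w) auto

lemma set_foldr_push: "set (foldr push u v) \<subseteq> set u \<union> set v"
  by (induction u) (use set_push in fastforce)+

lemma reduced_foldr_push [simp]: "reduced v \<Longrightarrow> reduced (foldr push u v)"
  by (induction u) auto

lemma foldr_push_push:
  assumes "reduced w"
  shows "foldr push (push x u) w = push x (foldr push u w)"
  using assms by (cases u) (auto simp: push_push_inv)

lemma foldr_push_assoc:
  assumes "reduced w"
  shows "foldr push (foldr push u v) w = foldr push u (foldr push v w)"
  using assms by (induction u) (auto simp: foldr_push_push)

lemma foldr_push_Nil: "reduced u \<Longrightarrow> foldr push u [] = u"
proof (induction u)
  case (Cons a u)
  then show ?case using reduced_ConsD[of a u] push_reduced_Cons[of a u] by simp
qed simp

lemma foldr_push_inv: "foldr push (map inv_letter (rev u)) u = []"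
  by (induction u) auto

lemma reduced_inv: "reduced u \<Longrightarrow> reduced (map inv_letter (rev u))"
  unfolding reduced_def successively_map successively_rev
  by (erule successively_mono) (metis inv_letter_invol)

lemma free_group_simps [simp]:
  "w \<in> carrier (free_group S) \<longleftrightarrow> reduced w \<and> fst ` set w \<subseteq> S"
  "u \<otimes>\<^bsub>free_group S\<^esub> v = foldr push u v"
  "\<one>\<^bsub>free_group S\<^esub> = []"
  by (auto simp: free_group_def)

lemma group_free_group: "group (free_group S)"
proof (rule groupI)
  fix u v assume "u \<in> carrier (free_group S)" "v \<in> carrier (free_group S)"
  then show "u \<otimes>\<^bsub>free_group S\<^esub> v \<in> carrier (free_group S)"
    using set_foldr_push[of u v] by (simp add: image_subset_iff) blast
next
  fix u assume u: "u \<in> carrier (free_group S)"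
  have "map inv_letter (rev u) \<in> carrier (free_group S)"
    using u by (auto simp: reduced_inv)
  then show "\<exists>v\<in>carrier (free_group S). v \<otimes>\<^bsub>free_group S\<^esub> u = \<one>\<^bsub>free_group S\<^esub>"
    using foldr_push_inv[of u] by (metis free_group_simps(2,3))
qed (auto simp: foldr_push_assoc)

lemma gen_in_carrier: "x \<in> S \<Longrightarrow> gen x \<in> carrier (free_group S)"
  by (simp add: gen_def reduced_def)

lemma inv_free_group:
  assumes "w \<in> carrier (free_group S)"
  shows "inv\<^bsub>free_group S\<^esub> w = map inv_letter (rev w)"
proof -
  interpret group "free_group S" by (rule group_free_group)
  show ?thesis
  proof (rule inv_equality)
    show "map inv_letter (rev w) \<in> carrier (free_group S)"
      using assms by (auto simp: reduced_inv)
    show "map inv_letter (rev w) \<otimes>\<^bsub>free_group S\<^esub> w = \<one>\<^bsub>free_group S\<^esub>"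
      using foldr_push_inv[of w] by simp
  qed (use assms in auto)
qed

lemma letter_eq:
  assumes "x \<in> S"
  shows "[(x, e)] = (if e then gen x else inv\<^bsub>free_group S\<^esub> (gen x))"
  using inv_free_group[OF gen_in_carrier[OF assms]] by (simp add: gen_def inv_letter_def)

lemma Cons_eq_mult:
  assumes "x # w \<in> carrier (free_group S)"
  shows "x # w = [x] \<otimes>\<^bsub>free_group S\<^esub> w"
    and "[x] \<in> carrier (free_group S)" and "w \<in> carrier (free_group S)"
proof -
  show "x # w = [x] \<otimes>\<^bsub>free_group S\<^esub> w"
    using assms push_reduced_Cons[of x w] by simp
  show "[x] \<in> carrier (free_group S)" "w \<in> carrier (free_group S)"
    using assms reduced_ConsD[of x w] by (auto simp: reduced_def[of "[x]"])
qed

lemma hom_Cons: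
  assumes "h \<in> hom (free_group S) G" "x # w \<in> carrier (free_group S)"
  shows "h (x # w) = h [x] \<otimes>\<^bsub>G\<^esub> h w"
  by (rule trans[OF arg_cong[OF Cons_eq_mult(1)[OF assms(2)], of h]
        hom_mult[OF assms(1) Cons_eq_mult(2,3)[OF assms(2)]]])

lemma free_group_hom_unique:
  assumes "group G" "h \<in> hom (free_group S) G" "h' \<in> hom (free_group S) G"
    and "\<And>x. x \<in> S \<Longrightarrow> h (gen x) = h' (gen x)" and "w \<in> carrier (free_group S)"
  shows "h w = h' w"
proof -
  interpret h: group_hom "free_group S" G h
    by (simp add: group_hom_def group_hom_axioms_def group_free_group assms)
  interpret h': group_hom "free_group S" G h'
    by (simp add: group_hom_def group_hom_axioms_def group_free_group assms)
  show ?thesis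
    using assms(5)
  proof (induction w)
    case Nil
    then show ?case using h.hom_one h'.hom_one by simp
  next
    case (Cons a w)
    obtain x e where a: "a = (x, e)" by fastforce
    have x: "x \<in> S" using Cons.prems a by simp
    have "h [a] = h' [a]"
      unfolding a letter_eq[OF x] using assms(4)[OF x] gen_in_carrier[OF x] by simp
    then show ?case
      unfolding hom_Cons[OF assms(2) Cons.prems] hom_Cons[OF assms(3) Cons.prems]
      using Cons.IH[OF Cons_eq_mult(3)[OF Cons.prems]] by simp
  qed
qed

lemma free_group_hom_exists:
  assumes "group G" "f \<in> S \<rightarrow> carrier G"
  shows "\<exists>h \<in> hom (free_group S) G. \<forall>x\<in>S. h (gen x) = f x"
proof -
  interpret G: group G by fact
  define g where "g = (\<lambda>x. if snd x then f (fst x) else inv\<^bsub>G\<^esub> f (fst x))"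
  define h where "h = (\<lambda>w. foldr (\<lambda>x a. g x \<otimes>\<^bsub>G\<^esub> a) w \<one>\<^bsub>G\<^esub>)"
  have g: "g x \<in> carrier G" if "fst x \<in> S" for x
    using assms(2) that by (auto simp: g_def)
  have g_inv: "g (inv_letter x) = inv\<^bsub>G\<^esub> g x" if "fst x \<in> S" for x
    using funcset_mem[OF assms(2) that] by (auto simp: g_def inv_letter_def)
  have h: "h w \<in> carrier G" if "fst ` set w \<subseteq> S" for w
    using that by (induction w) (auto simp: h_def g)
  have h_push: "h (push x w) = g x \<otimes>\<^bsub>G\<^esub> h w" if "fst x \<in> S" "fst ` set w \<subseteq> S" for x w
  proof (cases w)
    case (Cons y v)
    have "h v \<in> carrier G" using that Cons by (intro h) auto
    then have "g x \<otimes>\<^bsub>G\<^esub> (inv\<^bsub>G\<^esub> g x \<otimes>\<^bsub>G\<^esub> h v) = h v"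
      using g[OF that(1)] by (simp add: G.m_assoc[symmetric])
    then show ?thesis
      using Cons g_inv[OF that(1)] by (auto simp: h_def)
  qed (simp add: h_def)
  have h_mult: "h (foldr push u v) = h u \<otimes>\<^bsub>G\<^esub> h v"
    if "fst ` set u \<subseteq> S" "fst ` set v \<subseteq> S" for u v
    using that(1)
  proof (induction u)
    case Nil
    then show ?case using h[OF that(2)] by (simp add: h_def)
  next
    case (Cons x u)
    have "fst ` set (foldr push u v) \<subseteq> S"
      using set_foldr_push[of u v] Cons.prems that(2) by (simp add: image_subset_iff) blast
    moreover have "h (x # u) = g x \<otimes>\<^bsub>G\<^esub> h u" by (simp add: h_def)
    ultimately show ?case
      using Cons h_push[of x "foldr push u v"] h[OF that(2)] h[of u] g[of x]
      by (simp add: G.m_assoc)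
  qed
  have "h \<in> hom (free_group S) G"
    by (rule homI) (auto simp: h h_mult)
  moreover have "h (gen x) = f x" if "x \<in> S" for x
    using funcset_mem[OF assms(2) that] by (auto simp: h_def gen_def g_def)
  ultimately show ?thesis by blast
qed

section \<open>Abelianization of the free group\<close>

text \<open>\<open>abel n\<close> is the abelianization map of \<open>Fn n\<close> onto \<open>\<int>\<^sup>n\<close>; see \<open>abel_mult\<close>,
  \<open>abel_kernel\<close> and \<open>abel_surj\<close>.\<close>

definition exponent_sum :: "'a \<Rightarrow> ('a \<times> bool) list \<Rightarrow> int" where
  "exponent_sum i w = (\<Sum>x\<leftarrow>w. if fst x = i then (if snd x then 1 else -1) else 0)"

definition abel :: "nat \<Rightarrow> (nat \<times> bool) list \<Rightarrow> int vec" where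
  "abel n w = vec n (\<lambda>i. exponent_sum i w)"

lemma exponent_sum_simps [simp]:
  "exponent_sum i [] = 0"
  "exponent_sum i (x # w) =
     (if fst x = i then (if snd x then 1 else -1) else 0) + exponent_sum i w"
  by (auto simp: exponent_sum_def)

lemma exponent_sum_push:
  "exponent_sum i (push x w) = exponent_sum i [x] + exponent_sum i w"
  by (cases w) (auto simp: inv_letter_def)

lemma exponent_sum_mult:
  "exponent_sum i (foldr push u v) = exponent_sum i u + exponent_sum i v"
  by (induction u) (auto simp: exponent_sum_push)

lemma abel_carrier [simp]: "abel n w \<in> carrier_vec n"
  by (simp add: abel_def)

lemma abel_mult: "abel n (u \<otimes>\<^bsub>Fn n\<^esub> v) = abel n u + abel n v"
  by (rule eq_vecI) (auto simp: abel_def exponent_sum_mult)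

lemma abel_gen: "i < n \<Longrightarrow> abel n (gen i) = unit_vec n i"
  by (rule eq_vecI) (auto simp: abel_def gen_def)

lemma hom_to_comm_group:
  assumes "comm_group G" "h \<in> hom (Fn n) G" "w \<in> carrier (Fn n)"
  shows "h w = finprod G (\<lambda>i. h (gen i) [^]\<^bsub>G\<^esub> exponent_sum i w) {..<n}"
proof -
  interpret G: comm_group G by fact
  interpret h: group_hom "Fn n" G h
    by (simp add: group_hom_def group_hom_axioms_def group_free_group assms G.is_group)
  have hg: "h (gen i) \<in> carrier G" if "i < n" for i
    using that gen_in_carrier[of i "{..<n}"] h.hom_closed by blast
  show ?thesis
    using assms(3)
  proof (induction w)
    case Nil
    then show ?case using h.hom_one by simp
  next
    case (Cons a w)
    obtain x e where a: "a = (x, e)" by fastforce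
    have x: "x \<in> {..<n}" using Cons.prems a by simp
    let ?s = "if e then 1 else -1 :: int"
    have "h [a] = h (gen x) [^]\<^bsub>G\<^esub> ?s"
      unfolding a letter_eq[OF x] using hg[of x] x gen_in_carrier[OF x]
      by (auto simp: G.int_pow_neg)
    also have "\<dots> = finprod G (\<lambda>i. if x = i then h (gen i) [^]\<^bsub>G\<^esub> ?s else \<one>\<^bsub>G\<^esub>) {..<n}"
      using x hg by (intro G.finprod_singleton[symmetric]) auto
    also have "\<dots> = finprod G (\<lambda>i. h (gen i) [^]\<^bsub>G\<^esub> exponent_sum i [a]) {..<n}"
      using hg by (intro G.finprod_cong') (auto simp: a)
    finally have ha: "h [a] = \<dots>" .
    have "h (a # w) = h [a] \<otimes>\<^bsub>G\<^esub> h w"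
      by (rule hom_Cons[OF assms(2) Cons.prems])
    also have "\<dots> = finprod G (\<lambda>i. h (gen i) [^]\<^bsub>G\<^esub> exponent_sum i [a]
                                \<otimes>\<^bsub>G\<^esub> h (gen i) [^]\<^bsub>G\<^esub> exponent_sum i w) {..<n}"
      unfolding ha Cons.IH[OF Cons_eq_mult(3)[OF Cons.prems]]
      using hg by (intro G.finprod_multf[symmetric]) auto
    also have "\<dots> = finprod G (\<lambda>i. h (gen i) [^]\<^bsub>G\<^esub> exponent_sum i (a # w)) {..<n}"
      using hg by (intro G.finprod_cong') (auto simp: G.int_pow_mult)
    finally show ?case .
  qed
qed

lemma abel_kernel: "{w \<in> carrier (Fn n). abel n w = 0\<^sub>v n} = derived (Fn n) (carrier (Fn n))"
proof -
  interpret group "Fn n" by (rule group_free_group)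
  let ?D = "derived (Fn n) (carrier (Fn n))"
  interpret D: normal ?D "Fn n" by (rule derived_self_is_normal)
  have comm: "comm_group (Fn n Mod ?D)" by (rule derived_quot_is_comm_group)
  interpret Q: comm_group "Fn n Mod ?D" by (rule comm)
  have inv0: "exponent_sum i (inv\<^bsub>Fn n\<^esub> w) = - exponent_sum i w" if "w \<in> carrier (Fn n)" for w i
  proof -
    have "inv\<^bsub>Fn n\<^esub> w \<otimes>\<^bsub>Fn n\<^esub> w = \<one>\<^bsub>Fn n\<^esub>" using that l_inv by blast
    then have "foldr push (inv\<^bsub>Fn n\<^esub> w) w = []" by simp
    then show ?thesis using exponent_sum_mult[of i "inv\<^bsub>Fn n\<^esub> w" w] by simp
  qed
  have "w \<in> carrier (Fn n) \<and> (\<forall>i. exponent_sum i w = 0)" if "w \<in> ?D" for w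
    using that unfolding derived_def
  proof (induction rule: generate.induct)
    case (incl h)
    then obtain a b where ab: "a \<in> carrier (Fn n)" "b \<in> carrier (Fn n)"
      "h = a \<otimes>\<^bsub>Fn n\<^esub> b \<otimes>\<^bsub>Fn n\<^esub> inv\<^bsub>Fn n\<^esub> a \<otimes>\<^bsub>Fn n\<^esub> inv\<^bsub>Fn n\<^esub> b" by blast
    have "h \<in> carrier (Fn n)" unfolding ab(3) using ab(1,2) m_closed inv_closed by presburger
    moreover have "exponent_sum i h = 0" for i
      unfolding ab(3) by (simp only: free_group_simps(2) exponent_sum_mult inv0 ab(1,2))
    ultimately show ?case by blast
  next
    case (inv h)
    then obtain a b where ab: "a \<in> carrier (Fn n)" "b \<in> carrier (Fn n)"
      "h = a \<otimes>\<^bsub>Fn n\<^esub> b \<otimes>\<^bsub>Fn n\<^esub> inv\<^bsub>Fn n\<^esub> a \<otimes>\<^bsub>Fn n\<^esub> inv\<^bsub>Fn n\<^esub> b" by blast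
    have h: "h \<in> carrier (Fn n)" unfolding ab(3) using ab(1,2) m_closed inv_closed by presburger
    moreover have "exponent_sum i h = 0" for i
      unfolding ab(3) by (simp only: free_group_simps(2) exponent_sum_mult inv0 ab(1,2))
    ultimately show ?case using inv0 inv_closed by simp
  next
    case (eng h1 h2)
    then show ?case using m_closed[of h1 h2] by (simp add: exponent_sum_mult)
  qed simp
  then have "?D \<subseteq> {w \<in> carrier (Fn n). abel n w = 0\<^sub>v n}"
    by (auto simp: abel_def intro!: eq_vecI)
  moreover have "w \<in> ?D" if w: "w \<in> carrier (Fn n)" and a: "abel n w = 0\<^sub>v n" for w
  proof -
    have e: "exponent_sum i w = 0" if "i < n" for i
      using arg_cong[OF a, of "\<lambda>v. v $ i"] that by (simp add: abel_def)
    have "?D #>\<^bsub>Fn n\<^esub> w = finprod (Fn n Mod ?D)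
        (\<lambda>i. (?D #>\<^bsub>Fn n\<^esub> gen i) [^]\<^bsub>Fn n Mod ?D\<^esub> exponent_sum i w) {..<n}"
      by (rule hom_to_comm_group[OF comm D.r_coset_hom_Mod w])
    also have "\<dots> = finprod (Fn n Mod ?D) (\<lambda>i. \<one>\<^bsub>Fn n Mod ?D\<^esub>) {..<n}"
      using e Q.one_closed by (intro Q.finprod_cong') (auto simp del: one_FactGroup)
    also have "\<dots> = \<one>\<^bsub>Fn n Mod ?D\<^esub>" by (rule Q.finprod_one)
    also have "\<dots> = ?D" by simp
    finally show ?thesis
      using rcos_self[OF w D.subgroup_axioms] by simp
  qed
  ultimately show ?thesis by blast
qed

lemma abel_surj: "abel n ` carrier (Fn n) = carrier_vec n"
proof -
  have "v \<in> abel n ` carrier (Fn n)" if v: "v \<in> carrier_vec n" for v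
  proof -
    let ?u = "\<lambda>m. concat (map (\<lambda>i. replicate (nat \<bar>v $ i\<bar>) (i, v $ i \<ge> 0)) [0..<m])"
    have app: "exponent_sum i (a @ b) = exponent_sum i a + exponent_sum i b" for i and a b :: "(nat \<times> bool) list"
      by (simp add: exponent_sum_def)
    have rep: "exponent_sum i (replicate k (j, e)) = (if j = i then (if e then int k else - int k) else 0)"
      for i j :: nat and k e by (induction k) auto
    have u: "exponent_sum i (?u m) = (if i < m then v $ i else 0)" for i m
      by (induction m) (auto simp: app rep exponent_sum_simps(1))
    let ?w = "foldr push (?u n) []"
    have "?w \<in> carrier (Fn n)"
      using set_foldr_push[of "?u n" "[]"] by fastforce
    moreover have "abel n ?w = v"
      using v by (intro eq_vecI) (simp_all add: abel_def exponent_sum_mult u del: foldr_append)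
    ultimately show ?thesis by (intro image_eqI[where x = ?w]) (rule sym)
  qed
  then show ?thesis by auto
qed

section \<open>Automorphisms and outer automorphisms\<close>

text \<open>The matrix, with respect to the basis \<open>abel n (gen 0), \<dots>, abel n (gen (n - 1))\<close>, of the
  endomorphism of the abelianization that is induced by an endomorphism of \<open>Fn n\<close>;
  see \<open>abel_hom\<close>.\<close>

definition abel_mat :: "nat \<Rightarrow> ((nat \<times> bool) list \<Rightarrow> (nat \<times> bool) list) \<Rightarrow> int mat" where
  "abel_mat n \<phi> = mat_of_cols n (map (\<lambda>j. abel n (\<phi> (gen j))) [0..<n])"

lemma abel_mat_carrier [simp]: "abel_mat n \<phi> \<in> carrier_mat n n"
  by (simp add: abel_mat_def mat_of_cols_def)

lemma abel_hom:
  assumes "\<phi> \<in> hom (Fn n) (Fn n)" "w \<in> carrier (Fn n)"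
  shows "abel n (\<phi> w) = abel_mat n \<phi> *\<^sub>v abel n w"
proof -
  interpret group "Fn n" by (rule group_free_group)
  interpret \<phi>: group_hom "Fn n" "Fn n" \<phi>
    by (simp add: group_hom_def group_hom_axioms_def group_free_group assms)
  have abel0: "abel n [] = 0\<^sub>v n"
    by (auto simp: abel_def intro!: eq_vecI)
  have inv: "abel n (inv\<^bsub>Fn n\<^esub> u) = - abel n u" if "u \<in> carrier (Fn n)" for u
  proof -
    have "inv\<^bsub>Fn n\<^esub> u \<otimes>\<^bsub>Fn n\<^esub> u = \<one>\<^bsub>Fn n\<^esub>" using that l_inv by blast
    then have "foldr push (inv\<^bsub>Fn n\<^esub> u) u = []" by simp
    then have "exponent_sum i (inv\<^bsub>Fn n\<^esub> u) = - exponent_sum i u" for i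
      using exponent_sum_mult[of i "inv\<^bsub>Fn n\<^esub> u" u] by simp
    then show ?thesis by (auto simp: abel_def intro!: eq_vecI)
  qed
  show ?thesis
    using assms(2)
  proof (induction w)
    case Nil
    have "\<phi> [] = []" using \<phi>.hom_one by simp
    then show ?case using abel0 carrier_matD[OF abel_mat_carrier]
      by (auto intro!: eq_vecI simp: scalar_prod_def)
  next
    case (Cons a w)
    obtain x e where a: "a = (x, e)" by fastforce
    have x: "x \<in> {..<n}" using Cons.prems a by simp
    have g: "gen x \<in> carrier (Fn n)" by (rule gen_in_carrier[OF x])
    have gen: "abel n (\<phi> (gen x)) = abel_mat n \<phi> *\<^sub>v abel n (gen x)"
    proof -
      have "abel_mat n \<phi> *\<^sub>v unit_vec n x = col (abel_mat n \<phi>) x"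
        using x carrier_matD[OF abel_mat_carrier] by (intro eq_vecI) auto
      then show ?thesis using x by (simp add: abel_gen abel_mat_def)
    qed
    have "abel n (\<phi> [a]) = abel_mat n \<phi> *\<^sub>v abel n [a]"
    proof (cases e)
      case True
      then show ?thesis using gen by (simp add: a gen_def)
  next
      case False
      have "abel n (\<phi> [a]) = - abel n (\<phi> (gen x))"
        unfolding a letter_eq[OF x] using False g \<phi>.hom_inv[OF g] inv \<phi>.hom_closed by simp
      also have "\<dots> = abel_mat n \<phi> *\<^sub>v (- abel n (gen x))"
        unfolding gen by (intro eq_vecI) (auto simp: scalar_prod_def sum_negf abel_def)
      also have "- abel n (gen x) = abel n [a]"
        unfolding a letter_eq[OF x] using False inv[OF g] by simp
      finally show ?thesis .
    qed
    moreover have "abel n (a # w) = abel n [a] + abel n w"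
      by (rule trans[OF arg_cong[OF Cons_eq_mult(1)[OF Cons.prems], of "abel n"] abel_mult])
    moreover have "abel n (\<phi> (a # w)) = abel n (\<phi> [a]) + abel n (\<phi> w)"
      by (rule trans[OF arg_cong[OF hom_Cons[OF assms(1) Cons.prems], of "abel n"] abel_mult])
    ultimately show ?case
      using Cons.IH Cons_eq_mult(3)[OF Cons.prems]
      by (simp add: mult_add_distrib_mat_vec[OF abel_mat_carrier abel_carrier abel_carrier])
  qed
qed

definition SL :: "nat \<Rightarrow> int mat monoid" where
  "SL n = \<lparr>carrier = {A \<in> carrier_mat n n. det A = 1}, monoid.mult = (*), one = 1\<^sub>m n\<rparr>"

lemma group_SL: "group (SL n)"
proof (rule groupI)
  fix A assume A: "A \<in> carrier (SL n)"
  have "adj_mat A \<in> carrier_mat n n" "adj_mat A * A = 1\<^sub>m n" "A * adj_mat A = 1\<^sub>m n"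
    using A adj_mat[of A n] by (auto simp: SL_def)
  moreover from this A have "det (adj_mat A) = 1"
    using det_mult[of A n "adj_mat A"] by (auto simp: SL_def)
  ultimately show "\<exists>B\<in>carrier (SL n). B \<otimes>\<^bsub>SL n\<^esub> A = \<one>\<^bsub>SL n\<^esub>"
    by (auto simp: SL_def)
qed (auto simp: SL_def det_mult)

definition Aut :: "nat \<Rightarrow> ((nat \<times> bool) list \<Rightarrow> (nat \<times> bool) list) monoid" where
  "Aut n = AutoGroup (Fn n)"

definition Aut_plus :: "nat \<Rightarrow> ((nat \<times> bool) list \<Rightarrow> (nat \<times> bool) list) monoid" where
  "Aut_plus n = (Aut n)\<lparr>carrier := {\<phi> \<in> carrier (Aut n). abel_mat n \<phi> \<in> carrier (SL n)}\<rparr>"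

lemma Aut_carrierD:
  assumes "\<phi> \<in> carrier (Aut n)"
  shows "\<phi> \<in> hom (Fn n) (Fn n)" "\<phi> \<in> Bij (carrier (Fn n))"
  using assms by (auto simp: Aut_def AutoGroup_def auto_def)

lemma group_Aut: "group (Aut n)"
  unfolding Aut_def by (rule group.AutoGroup[OF group_free_group])

lemma Aut_mult_apply:
  assumes "\<phi> \<in> carrier (Aut n)" "\<psi> \<in> carrier (Aut n)" "w \<in> carrier (Fn n)"
  shows "(\<phi> \<otimes>\<^bsub>Aut n\<^esub> \<psi>) w = \<phi> (\<psi> w)"
  using assms Aut_carrierD(2)[OF assms(1)] Aut_carrierD(2)[OF assms(2)]
  by (simp add: Aut_def AutoGroup_def BijGroup_def compose_def)

lemma abel_mat_mult:
  assumes "\<phi> \<in> carrier (Aut n)" "\<psi> \<in> carrier (Aut n)"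
  shows "abel_mat n (\<phi> \<otimes>\<^bsub>Aut n\<^esub> \<psi>) = abel_mat n \<phi> * abel_mat n \<psi>"
proof (rule mat_col_eqI)
  fix j assume "j < dim_col (abel_mat n \<phi> * abel_mat n \<psi>)"
  then have j: "j < n" using carrier_matD[OF abel_mat_carrier] by simp
  then have g: "gen j \<in> carrier (Fn n)" by (intro gen_in_carrier) simp
  have c: "col (abel_mat n \<chi>) j = abel n (\<chi> (gen j))" for \<chi>
    using j by (simp add: abel_mat_def)
  have "\<psi> (gen j) \<in> carrier (Fn n)"
    using Aut_carrierD(1)[OF assms(2)] g unfolding hom_def by blast
  then show "col (abel_mat n (\<phi> \<otimes>\<^bsub>Aut n\<^esub> \<psi>)) j = col (abel_mat n \<phi> * abel_mat n \<psi>) j"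
    using abel_hom[OF Aut_carrierD(1)[OF assms(1)]] j
    by (simp only: col_mult2[OF abel_mat_carrier abel_mat_carrier] c Aut_mult_apply[OF assms g])
qed (use carrier_matD[OF abel_mat_carrier] in auto)

lemma abel_mat_one: "abel_mat n \<one>\<^bsub>Aut n\<^esub> = 1\<^sub>m n"
proof (rule mat_col_eqI)
  fix j assume "j < dim_col (1\<^sub>m n :: int mat)"
  then have j: "j < n" by simp
  then have "gen j \<in> carrier (Fn n)" by (intro gen_in_carrier) simp
  then have "\<one>\<^bsub>Aut n\<^esub> (gen j) = gen j"
    by (simp add: Aut_def AutoGroup_def BijGroup_def)
  then show "col (abel_mat n \<one>\<^bsub>Aut n\<^esub>) j = col (1\<^sub>m n) j"
    using j by (simp add: abel_mat_def abel_gen)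
qed (use carrier_matD[OF abel_mat_carrier] in auto)

lemma subgroup_Aut_plus: "subgroup (carrier (Aut_plus n)) (Aut n)"
proof -
  interpret group "Aut n" by (rule group_Aut)
  show ?thesis
  proof (rule subgroupI)
    show "carrier (Aut_plus n) \<noteq> {}"
      using abel_mat_one[of n] one_closed by (auto simp: Aut_plus_def SL_def)
    fix \<phi> assume \<phi>: "\<phi> \<in> carrier (Aut_plus n)"
    then have c: "\<phi> \<in> carrier (Aut n)" by (simp add: Aut_plus_def)
    have "abel_mat n \<phi> * abel_mat n (inv\<^bsub>Aut n\<^esub> \<phi>) = 1\<^sub>m n"
      using abel_mat_mult[OF c inv_closed[OF c]] abel_mat_one r_inv[OF c] by simp
    then have "det (abel_mat n \<phi>) * det (abel_mat n (inv\<^bsub>Aut n\<^esub> \<phi>)) = 1"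
      using det_mult[OF abel_mat_carrier abel_mat_carrier] by (metis det_one)
    then show "inv\<^bsub>Aut n\<^esub> \<phi> \<in> carrier (Aut_plus n)"
      using \<phi> inv_closed[OF c] by (simp add: Aut_plus_def SL_def)
  qed (auto simp: Aut_plus_def SL_def abel_mat_mult
         det_mult[OF abel_mat_carrier abel_mat_carrier])
qed

lemma group_Aut_plus: "group (Aut_plus n)"
  using group.subgroup_imp_group[OF group_Aut subgroup_Aut_plus[of n]]
  by (simp add: Aut_plus_def)

definition Inn :: "('a, 'b) monoid_scheme \<Rightarrow> ('a \<Rightarrow> 'a) set" where
  "Inn G = (\<lambda>g. \<lambda>x\<in>carrier G. g \<otimes>\<^bsub>G\<^esub> x \<otimes>\<^bsub>G\<^esub> inv\<^bsub>G\<^esub> g) ` carrier G"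

definition Out :: "nat \<Rightarrow> ((nat \<times> bool) list \<Rightarrow> (nat \<times> bool) list) set monoid" where
  "Out n = Aut n Mod Inn (Fn n)"

lemma hom_conjugation_Aut:
  "(\<lambda>g. \<lambda>x\<in>carrier (Fn n). g \<otimes>\<^bsub>Fn n\<^esub> x \<otimes>\<^bsub>Fn n\<^esub> inv\<^bsub>Fn n\<^esub> g) \<in> hom (Fn n) (Aut n)"
proof -
  interpret group "Fn n" by (rule group_free_group)
  let ?c = "\<lambda>g. \<lambda>x\<in>carrier (Fn n). g \<otimes>\<^bsub>Fn n\<^esub> x \<otimes>\<^bsub>Fn n\<^esub> inv\<^bsub>Fn n\<^esub> g"
  have B: "?c \<in> hom (Fn n) (BijGroup (carrier (Fn n)))" by (rule conjugation_is_hom)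
  have "?c g \<in> hom (Fn n) (Fn n)" if g: "g \<in> carrier (Fn n)" for g
  proof (rule homI)
    fix x y assume xy: "x \<in> carrier (Fn n)" "y \<in> carrier (Fn n)"
    have "inv\<^bsub>Fn n\<^esub> g \<otimes>\<^bsub>Fn n\<^esub> (g \<otimes>\<^bsub>Fn n\<^esub> z) = z" if "z \<in> carrier (Fn n)" for z
      using g that by (simp add: m_assoc[symmetric] del: free_group_simps)
    then have "g \<otimes>\<^bsub>Fn n\<^esub> (x \<otimes>\<^bsub>Fn n\<^esub> y) \<otimes>\<^bsub>Fn n\<^esub> inv\<^bsub>Fn n\<^esub> g =
       (g \<otimes>\<^bsub>Fn n\<^esub> x \<otimes>\<^bsub>Fn n\<^esub> inv\<^bsub>Fn n\<^esub> g) \<otimes>\<^bsub>Fn n\<^esub> (g \<otimes>\<^bsub>Fn n\<^esub> y \<otimes>\<^bsub>Fn n\<^esub> inv\<^bsub>Fn n\<^esub> g)"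
      using g xy by (simp add: m_assoc del: free_group_simps)
    then show "?c g (x \<otimes>\<^bsub>Fn n\<^esub> y) = ?c g x \<otimes>\<^bsub>Fn n\<^esub> ?c g y"
      using xy m_closed[OF xy] by (simp del: free_group_simps)
  qed (use g in \<open>simp del: free_group_simps\<close>)
  moreover have "carrier (Aut n) = hom (Fn n) (Fn n) \<inter> carrier (BijGroup (carrier (Fn n)))"
    by (simp add: Aut_def AutoGroup_def auto_def BijGroup_def)
  ultimately have "?c g \<in> carrier (Aut n)" if "g \<in> carrier (Fn n)" for g
    using that hom_in_carrier[OF B that] by (simp only: Int_iff)
  moreover have "monoid.mult (Aut n) = monoid.mult (BijGroup (carrier (Fn n)))"
    by (simp add: Aut_def AutoGroup_def)
  then have "?c (g \<otimes>\<^bsub>Fn n\<^esub> h) = ?c g \<otimes>\<^bsub>Aut n\<^esub> ?c h"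
    if "g \<in> carrier (Fn n)" "h \<in> carrier (Fn n)" for g h
    using hom_mult[OF B that] by (simp only:)
  ultimately show ?thesis by (rule homI)
qed

lemma Inn_normal: "Inn (Fn n) \<lhd> Aut n"
proof -
  interpret F: group "Fn n" by (rule group_free_group)
  interpret A: group "Aut n" by (rule group_Aut)
  let ?c = "\<lambda>g. \<lambda>x\<in>carrier (Fn n). g \<otimes>\<^bsub>Fn n\<^esub> x \<otimes>\<^bsub>Fn n\<^esub> inv\<^bsub>Fn n\<^esub> g"
  interpret c: group_hom "Fn n" "Aut n" ?c
    by (simp add: group_hom_def group_hom_axioms_def group_free_group group_Aut
        hom_conjugation_Aut del: free_group_simps)
  have sub: "subgroup (Inn (Fn n)) (Aut n)"
    unfolding Inn_def by (rule c.img_is_subgroup)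
  have "\<phi> \<otimes>\<^bsub>Aut n\<^esub> ?c g \<otimes>\<^bsub>Aut n\<^esub> inv\<^bsub>Aut n\<^esub> \<phi> \<in> Inn (Fn n)"
    if \<phi>: "\<phi> \<in> carrier (Aut n)" and g: "g \<in> carrier (Fn n)" for \<phi> g
  proof -
    interpret \<phi>: group_hom "Fn n" "Fn n" \<phi>
      by (simp add: group_hom_def group_hom_axioms_def group_free_group Aut_carrierD(1)[OF \<phi>])
    have cg: "?c g \<in> carrier (Aut n)" using g by (rule c.hom_closed)
    have \<phi>g: "\<phi> g \<in> carrier (Fn n)" using g by (rule \<phi>.hom_closed)
    have c\<phi>g: "?c (\<phi> g) \<in> carrier (Aut n)" using \<phi>g by (rule c.hom_closed)
    have "\<phi> \<otimes>\<^bsub>Aut n\<^esub> ?c g = ?c (\<phi> g) \<otimes>\<^bsub>Aut n\<^esub> \<phi>"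
    proof (rule extensionalityI[of _ "carrier (Fn n)"])
      fix x assume x: "x \<in> carrier (Fn n)"
      show "(\<phi> \<otimes>\<^bsub>Aut n\<^esub> ?c g) x = (?c (\<phi> g) \<otimes>\<^bsub>Aut n\<^esub> \<phi>) x"
        unfolding Aut_mult_apply[OF \<phi> cg x] Aut_mult_apply[OF c\<phi>g \<phi> x]
        using x g by (simp del: free_group_simps)
    qed (use A.m_closed[OF \<phi> cg] A.m_closed[OF c\<phi>g \<phi>] Aut_carrierD(2) Bij_imp_extensional in blast)+
    then have "\<phi> \<otimes>\<^bsub>Aut n\<^esub> ?c g \<otimes>\<^bsub>Aut n\<^esub> inv\<^bsub>Aut n\<^esub> \<phi> = ?c (\<phi> g)"
      using \<phi> c\<phi>g by (simp add: A.m_assoc del: free_group_simps restrict_apply)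
    then show ?thesis using \<phi>g by (auto simp: Inn_def simp del: free_group_simps)
  qed
  then show ?thesis
    using sub by (auto simp: A.normal_inv_iff Inn_def simp del: free_group_simps)
qed

lemma group_Out: "group (Out n)"
  unfolding Out_def by (rule normal.factorgroup_is_group[OF Inn_normal])

lemma abel_mat_Inn:
  assumes "\<iota> \<in> Inn (Fn n)"
  shows "abel_mat n \<iota> = 1\<^sub>m n"
proof -
  interpret F: group "Fn n" by (rule group_free_group)
  obtain g where g: "g \<in> carrier (Fn n)" and
    \<iota>: "\<iota> = (\<lambda>x\<in>carrier (Fn n). g \<otimes>\<^bsub>Fn n\<^esub> x \<otimes>\<^bsub>Fn n\<^esub> inv\<^bsub>Fn n\<^esub> g)"
    using assms unfolding Inn_def by blast
  have "abel n (g \<otimes>\<^bsub>Fn n\<^esub> inv\<^bsub>Fn n\<^esub> g) = abel n \<one>\<^bsub>Fn n\<^esub>" using F.r_inv[OF g] by metis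
  then have s: "abel n g + abel n (inv\<^bsub>Fn n\<^esub> g) = 0\<^sub>v n"
    unfolding abel_mult by (auto simp: abel_def intro!: eq_vecI)
  show ?thesis
  proof (rule mat_col_eqI)
    fix j assume "j < dim_col (1\<^sub>m n :: int mat)"
    then have j: "j < n" by simp
    then have "gen j \<in> carrier (Fn n)" by (intro gen_in_carrier) simp
    then have "abel n (\<iota> (gen j)) = abel n g + abel n (gen j) + abel n (inv\<^bsub>Fn n\<^esub> g)"
      unfolding \<iota> by (simp add: abel_mult del: free_group_simps)
    also have "\<dots> = abel n (gen j) + (abel n g + abel n (inv\<^bsub>Fn n\<^esub> g))"
      by (auto intro!: eq_vecI simp: abel_def)
    also have "\<dots> = unit_vec n j" unfolding s using j by (simp add: abel_gen)
    finally show "col (abel_mat n \<iota>) j = col (1\<^sub>m n) j"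
      using j by (simp add: abel_mat_def)
  qed (use carrier_matD[OF abel_mat_carrier] in auto)
qed

lemma abel_mat_coset:
  assumes "C \<in> carrier (Out n)" "\<phi> \<in> C"
  shows "abel_mat n ` C = {abel_mat n \<phi>}"
proof -
  interpret normal "Inn (Fn n)" "Aut n" by (rule Inn_normal)
  obtain \<psi> where \<psi>: "\<psi> \<in> carrier (Aut n)" and C: "C = Inn (Fn n) #>\<^bsub>Aut n\<^esub> \<psi>"
    using assms(1) by (auto simp: Out_def FactGroup_def RCOSETS_def)
  have eq: "abel_mat n \<chi> = abel_mat n \<psi>" if \<chi>: "\<chi> \<in> C" for \<chi>
  proof -
    obtain \<iota> where \<iota>: "\<iota> \<in> Inn (Fn n)" "\<chi> = \<iota> \<otimes>\<^bsub>Aut n\<^esub> \<psi>"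
      using \<chi> by (auto simp: C r_coset_def)
    have "abel_mat n \<chi> = abel_mat n \<iota> * abel_mat n \<psi>"
      unfolding \<iota>(2) by (rule abel_mat_mult[OF mem_carrier[OF \<iota>(1)] \<psi>])
    then show ?thesis
      unfolding abel_mat_Inn[OF \<iota>(1)] by (simp add: left_mult_one_mat[OF abel_mat_carrier])
  qed
  have "abel_mat n ` C = (\<lambda>_. abel_mat n \<psi>) ` C"
    by (rule image_cong[OF refl eq])
  also have "\<dots> = {abel_mat n \<psi>}" by (rule image_constant[OF assms(2)])
  finally show ?thesis unfolding eq[OF assms(2)] .
qed

text \<open>\<open>abel_mat n\<close> is constant on each element \<open>C\<close> of \<open>Out n\<close>, which is a coset of the inner
  automorphisms; \<open>the_elem (abel_mat n ` C)\<close> is its value there.\<close>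

definition Out_plus :: "nat \<Rightarrow> ((nat \<times> bool) list \<Rightarrow> (nat \<times> bool) list) set monoid" where
  "Out_plus n =
     (Out n)\<lparr>carrier := {C \<in> carrier (Out n). the_elem (abel_mat n ` C) \<in> carrier (SL n)}\<rparr>"

text \<open>The element order \<open>group.ord\<close> of the library is \<open>0\<close> on elements of infinite order.\<close>

definition generated_by_elements_of_order :: "('a, 'b) monoid_scheme \<Rightarrow> nat \<Rightarrow> nat \<Rightarrow> bool" where
  "generated_by_elements_of_order G m k \<longleftrightarrow>
     (\<exists>A \<subseteq> carrier G. finite A \<and> card A \<le> m \<and> (\<forall>a\<in>A. group.ord G a = k) \<and>
        generate G A = carrier G)"

end

(* Write t(i,j) for the transvection x_i -> x_i x_j (or x_i -> x_j x_i).  By Nielsen reduction these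
   generate Aut^+(F_n), and integral column reduction shows that Aut^+(F_n) maps onto SL(n,Z).  So it
   is enough to generate Aut^+(F_n) by elements of order k whose images in SL(n,Z) have order exactly
   k; the outer automorphism group lies between the two.

   For k >= 5 and n > k five elements suffice: the product s of the rotations of the blocks
   {0..k-1}, {k..2k-1}, ..., the same rotations shifted by 1, the rotation of the last k generators,
   and t^-1 s t for t = t(0,1) of either kind.  Indeed t(0,1)^-1 s t(0,1) s^-1 = t(0,1)^-1 t(1,2), and
   conjugation by s gives t(i,i+1)^-1 t(i+1,i+2) for i = 1, 2.  Commutators of these products isolate
   t(1,3) and t(1,4), because the unwanted factors commute.  Call i and j linked if t(i,j) of both
   kinds lie in the group; linking is transitive since the commutator of t(i,j) and t(j,l) is t(i,l),
   and it is preserved by the rotations.  As 2 and 3 generate Z/k, the first block is linked, and the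
   shifted rotations carry this over to all generators. *)

theory Submission
  imports Defs "HOL-Combinatorics.Cycles"
begin

text \<open>A rotation of k points is odd when k is even, so a product of block rotations may have
  determinant -1. The repair is to invert a generator that the permutation fixes, so no rotation may
  move all n generators: there are only (n - 1) div k blocks, hence the blocks starting at 0 miss n
  - 1 and the blocks starting at 1 miss 0. The rotation of the last k generators reaches what the
  blocks leave over. The price of the repair is that conjugation may exchange the two kinds of
  transvection, or invert one, when the inverted generator is involved; links therefore always carry
  both kinds. Isolating t(1,3) and t(1,4) takes place on the five points 0..4, away from the
  inverted generator, and this is where k >= 5 enters.

  In the Nielsen reduction, total length alone is not a sufficient measure: a word may lose exactly
  half to each neighbour and vanish although no move shortens anything. A second measure on initial
  halves of words breaks these ties. A minimal \<phi> then never shortens a word, so its inverse,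
  rather than \<phi> itself, is seen directly to send generators to single letters.\<close>

declare free_group_simps [simp del]

interpretation Fn: group "Fn n" for n
  by (rule group_free_group)

interpretation Aut: group "Aut n" for n
  by (rule group_Aut)

section \<open>Automorphisms given by their values on the generators\<close>

abbreviation winv :: "('a \<times> bool) list \<Rightarrow> ('a \<times> bool) list" where
  "winv w \<equiv> map inv_letter (rev w)"

lemma letter_in_carrier [simp]: "[(i, e)] \<in> carrier (Fn n) \<longleftrightarrow> i < n"
  by (simp add: free_group_simps reduced_def)

lemma gen_in_Fn [simp]: "gen i \<in> carrier (Fn n) \<longleftrightarrow> i < n"
  by (simp add: gen_def)

lemma inv_letter_word: "i < n \<Longrightarrow> inv\<^bsub>Fn n\<^esub> [(i, e)] = [(i, \<not> e)]"
  by (simp add: inv_free_group inv_letter_def)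

lemma Aut_group_hom: "\<phi> \<in> carrier (Aut n) \<Longrightarrow> group_hom (Fn n) (Fn n) \<phi>"
  by (simp add: group_hom_def group_hom_axioms_def group_free_group Aut_carrierD)

lemma Aut_apply_closed [simp]:
  "\<phi> \<in> carrier (Aut n) \<Longrightarrow> w \<in> carrier (Fn n) \<Longrightarrow> \<phi> w \<in> carrier (Fn n)"
  by (rule hom_in_carrier[OF Aut_carrierD(1)])

lemma Aut_apply_mult:
  "\<phi> \<in> carrier (Aut n) \<Longrightarrow> v \<in> carrier (Fn n) \<Longrightarrow> w \<in> carrier (Fn n) \<Longrightarrow>
    \<phi> (v \<otimes>\<^bsub>Fn n\<^esub> w) = \<phi> v \<otimes>\<^bsub>Fn n\<^esub> \<phi> w"
  by (rule hom_mult[OF Aut_carrierD(1)])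

lemma Aut_apply_inv:
  "\<phi> \<in> carrier (Aut n) \<Longrightarrow> w \<in> carrier (Fn n) \<Longrightarrow> \<phi> (inv\<^bsub>Fn n\<^esub> w) = inv\<^bsub>Fn n\<^esub> \<phi> w"
  by (rule group_hom.hom_inv[OF Aut_group_hom])

lemma Aut_apply_letter:
  assumes "\<phi> \<in> carrier (Aut n)" "i < n"
  shows "\<phi> [(i, e)] = (if e then \<phi> (gen i) else inv\<^bsub>Fn n\<^esub> \<phi> (gen i))"
  using assms Aut_apply_inv[OF assms(1), of "gen i"] by (simp add: gen_def inv_letter_word)

lemma Aut_apply_inj:
  "\<phi> \<in> carrier (Aut n) \<Longrightarrow> v \<in> carrier (Fn n) \<Longrightarrow> w \<in> carrier (Fn n) \<Longrightarrow> \<phi> v = \<phi> w \<longleftrightarrow> v = w"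
  using Aut_carrierD(2)[of \<phi> n] unfolding Bij_def bij_betw_def inj_on_def by blast

lemma Aut_one_apply [simp]: "w \<in> carrier (Fn n) \<Longrightarrow> \<one>\<^bsub>Aut n\<^esub> w = w"
  by (simp add: Aut_def AutoGroup_def BijGroup_def)

lemma Aut_eqI:
  assumes "\<phi> \<in> carrier (Aut n)" "\<psi> \<in> carrier (Aut n)" "\<And>i. i < n \<Longrightarrow> \<phi> (gen i) = \<psi> (gen i)"
  shows "\<phi> = \<psi>"
proof (rule extensionalityI[of _ "carrier (Fn n)"])
  show "\<phi> w = \<psi> w" if "w \<in> carrier (Fn n)" for w
    by (rule free_group_hom_unique[OF group_free_group _ _ _ that]) (use assms Aut_carrierD in auto)
qed (use assms Aut_carrierD(2) Bij_imp_extensional in blast)+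

lemma Aut_inv_apply:
  assumes "\<phi> \<in> carrier (Aut n)" "w \<in> carrier (Fn n)"
  shows "\<phi> ((inv\<^bsub>Aut n\<^esub> \<phi>) w) = w" "(inv\<^bsub>Aut n\<^esub> \<phi>) (\<phi> w) = w"
  using Aut_mult_apply[of \<phi> n "inv\<^bsub>Aut n\<^esub> \<phi>" w] Aut_mult_apply[of "inv\<^bsub>Aut n\<^esub> \<phi>" n \<phi> w] assms
  by auto

text \<open>Elements of \<open>Aut n\<close> are extensional functions. The universal property
  determines the homomorphism on the carrier only, so restricting it makes the choice
  immaterial.\<close>

definition endo :: "nat \<Rightarrow> (nat \<Rightarrow> (nat \<times> bool) list) \<Rightarrow> (nat \<times> bool) list \<Rightarrow> (nat \<times> bool) list" where
  "endo n u = restrict (SOME h. h \<in> hom (Fn n) (Fn n) \<and> (\<forall>i<n. h (gen i) = u i)) (carrier (Fn n))"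

lemma endo:
  assumes "\<And>i. i < n \<Longrightarrow> u i \<in> carrier (Fn n)"
  shows "endo n u \<in> hom (Fn n) (Fn n)" and endo_gen: "i < n \<Longrightarrow> endo n u (gen i) = u i"
    and "endo n u \<in> extensional (carrier (Fn n))"
proof -
  let ?P = "\<lambda>h. h \<in> hom (Fn n) (Fn n) \<and> (\<forall>i<n. h (gen i) = u i)"
  have "\<exists>h. ?P h"
    using free_group_hom_exists[OF group_free_group[of "{..<n}"], of u "{..<n}"] assms by auto
  then have P: "?P (Eps ?P)" by (rule someI_ex)
  then show "endo n u \<in> hom (Fn n) (Fn n)" "i < n \<Longrightarrow> endo n u (gen i) = u i"
    by (auto simp: endo_def hom_def Pi_iff)
qed (simp add: endo_def)

text \<open>Both composites are homomorphisms that agree with the identity on the generators, hence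
  everywhere on the carrier. Bijectivity thus reduces to computing finitely many words.\<close>

lemma endo_in_Aut:
  assumes u: "\<And>i. i < n \<Longrightarrow> u i \<in> carrier (Fn n)" and v: "\<And>i. i < n \<Longrightarrow> v i \<in> carrier (Fn n)"
    and uv: "\<And>i. i < n \<Longrightarrow> endo n u (v i) = gen i" and vu: "\<And>i. i < n \<Longrightarrow> endo n v (u i) = gen i"
  shows "endo n u \<in> carrier (Aut n)"
proof -
  have inverse: "endo n u (endo n v w) = w"
    if u: "\<And>i. i < n \<Longrightarrow> u i \<in> carrier (Fn n)" and v: "\<And>i. i < n \<Longrightarrow> v i \<in> carrier (Fn n)"
      and uv: "\<And>i. i < n \<Longrightarrow> endo n u (v i) = gen i" and w: "w \<in> carrier (Fn n)" for u v w
  proof -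
    have "endo n u \<circ> endo n v \<in> hom (Fn n) (Fn n)"
      using Group.hom_compose[OF endo(1)[of n v, OF v] endo(1)[of n u, OF u]] by (simp add: comp_def)
    moreover have "id \<in> hom (Fn n) (Fn n)" by (simp add: hom_def)
    ultimately have "(endo n u \<circ> endo n v) w = id w"
      by (rule free_group_hom_unique[OF group_free_group _ _ _ w]) (use endo_gen[of n v, OF v] uv in auto)
    then show ?thesis by simp
  qed
  have closed: "endo n u w \<in> carrier (Fn n)" "endo n v w \<in> carrier (Fn n)"
    if "w \<in> carrier (Fn n)" for w
    using that hom_in_carrier[OF endo(1)[of n u, OF u]] hom_in_carrier[OF endo(1)[of n v, OF v]]
    by blast+
  have "bij_betw (endo n u) (carrier (Fn n)) (carrier (Fn n))"
    by (rule bij_betw_byWitness[where f' = "endo n v"])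
      (use closed inverse[of u v, OF u v uv] inverse[of v u, OF v u vu] in blast)+
  then show ?thesis
    using endo(1,3)[of n u, OF u] by (simp add: Aut_def AutoGroup_def auto_def Bij_def)
qed

section \<open>Nielsen transvections and signed permutations\<close>

definition transvection :: "nat \<Rightarrow> bool \<Rightarrow> nat \<Rightarrow> nat \<Rightarrow> (nat \<times> bool) list \<Rightarrow> (nat \<times> bool) list" where
  "transvection n b i j = endo n (\<lambda>l. if l = i then (if b then gen i \<otimes>\<^bsub>Fn n\<^esub> gen j
     else gen j \<otimes>\<^bsub>Fn n\<^esub> gen i) else gen l)"

lemma transvection_gen:
  assumes "i < n" "j < n" "l < n"
  shows "transvection n b i j (gen l) = (if l = i then (if b then gen i \<otimes>\<^bsub>Fn n\<^esub> gen j
     else gen j \<otimes>\<^bsub>Fn n\<^esub> gen i) else gen l)"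
  unfolding transvection_def by (subst endo_gen) (use assms in auto)

lemma transvection_in_Aut [simp]:
  assumes "i < n" "j < n" "i \<noteq> j"
  shows "transvection n b i j \<in> carrier (Aut n)"
proof -
  let ?u = "\<lambda>l. if l = i then (if b then gen i \<otimes>\<^bsub>Fn n\<^esub> gen j
     else gen j \<otimes>\<^bsub>Fn n\<^esub> gen i) else gen l"
  let ?v = "\<lambda>l. if l = i then (if b then gen i \<otimes>\<^bsub>Fn n\<^esub> inv\<^bsub>Fn n\<^esub> gen j
     else inv\<^bsub>Fn n\<^esub> gen j \<otimes>\<^bsub>Fn n\<^esub> gen i) else gen l"
  have u: "?u l \<in> carrier (Fn n)" and v: "?v l \<in> carrier (Fn n)" if "l < n" for l
    using that assms by auto
  have hom: "group_hom (Fn n) (Fn n) (endo n ?u)" "group_hom (Fn n) (Fn n) (endo n ?v)"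
    using endo(1)[of n ?u, OF u] endo(1)[of n ?v, OF v]
    by (auto simp: group_hom_def group_hom_axioms_def group_free_group)
  interpret u: group_hom "Fn n" "Fn n" "endo n ?u" by (rule hom)
  interpret v: group_hom "Fn n" "Fn n" "endo n ?v" by (rule hom)
  have gu: "endo n ?u (gen l) = ?u l" and gv: "endo n ?v (gen l) = ?v l" if "l < n" for l
    using endo_gen[of n ?u, OF u that] endo_gen[of n ?v, OF v that] by blast+
  show ?thesis
    unfolding transvection_def
  proof (rule endo_in_Aut[of n ?u ?v])
    show "endo n ?u (?v l) = gen l" if "l < n" for l
      using assms that by (auto simp: gu Fn.m_assoc) (simp add: Fn.m_assoc[symmetric])
    show "endo n ?v (?u l) = gen l" if "l < n" for l
      using assms that by (auto simp: gv Fn.m_assoc) (simp add: Fn.m_assoc[symmetric])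
  qed (use u v in auto)
qed

definition signed_perm :: "nat \<Rightarrow> (nat \<Rightarrow> nat) \<Rightarrow> (nat \<Rightarrow> bool) \<Rightarrow> (nat \<times> bool) list \<Rightarrow> (nat \<times> bool) list" where
  "signed_perm n p e = endo n (\<lambda>i. [(p i, e i)])"

lemma permutes_lessThan: "p permutes {..<n} \<Longrightarrow> i < n \<Longrightarrow> p i < (n::nat)"
  using permutes_in_image[of p "{..<n}" i] by simp

lemma signed_perm_gen:
  assumes "p permutes {..<n}" "i < n"
  shows "signed_perm n p e (gen i) = [(p i, e i)]"
  unfolding signed_perm_def by (subst endo_gen) (use assms permutes_lessThan in auto)

lemma signed_perm_in_Aut [simp]:
  assumes p: "p permutes {..<n}"
  shows "signed_perm n p e \<in> carrier (Aut n)"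
proof -
  let ?q = "inv_into UNIV p"
  let ?u = "\<lambda>i. [(p i, e i)]"
  let ?v = "\<lambda>i. [(?q i, e (?q i))]"
  have u: "?u l \<in> carrier (Fn n)" and v: "?v l \<in> carrier (Fn n)" if "l < n" for l
    using that permutes_lessThan[OF p] permutes_lessThan[OF permutes_inv[OF p]] by auto
  have hom: "group_hom (Fn n) (Fn n) (endo n ?u)" "group_hom (Fn n) (Fn n) (endo n ?v)"
    using endo(1)[of n ?u, OF u] endo(1)[of n ?v, OF v]
    by (auto simp: group_hom_def group_hom_axioms_def group_free_group)
  interpret u: group_hom "Fn n" "Fn n" "endo n ?u" by (rule hom)
  interpret v: group_hom "Fn n" "Fn n" "endo n ?v" by (rule hom)
  have gu: "endo n ?u [(l, d)] = [(p l, d = e l)]" if "l < n" for l d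
    using endo_gen[of n ?u, OF u that] u.hom_inv[of "gen l"] that permutes_lessThan[OF p that]
    by (cases d) (auto simp: gen_def inv_letter_word)
  have gv: "endo n ?v [(l, d)] = [(?q l, d = e (?q l))]" if "l < n" for l d
    using endo_gen[of n ?v, OF v that] v.hom_inv[of "gen l"] that
      permutes_lessThan[OF permutes_inv[OF p] that]
    by (cases d) (auto simp: gen_def inv_letter_word)
  show ?thesis
    unfolding signed_perm_def
  proof (rule endo_in_Aut[of n ?u ?v])
    show "endo n ?u (?v l) = gen l" if "l < n" for l
      using permutes_lessThan[OF permutes_inv[OF p] that] permutes_inverses[OF p]
      by (simp add: gu gen_def)
    show "endo n ?v (?u l) = gen l" if "l < n" for l
      using permutes_lessThan[OF p that] permutes_inverses[OF p]
      by (simp add: gv gen_def)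
  qed (use u v in auto)
qed

text \<open>Equality of Booleans serves as multiplication of signs, with \<open>True\<close> for
  plus.\<close>

lemma signed_perm_letter:
  assumes "p permutes {..<n}" "i < n"
  shows "signed_perm n p e [(i, d)] = [(p i, d = e i)]"
  using assms permutes_lessThan[OF assms]
    Aut_apply_letter[OF signed_perm_in_Aut[OF assms(1)] assms(2), of e d]
  by (auto simp: signed_perm_gen inv_letter_word)


text \<open>Steinberg's relation, arranged without inverses so that only positive words are
  compared: both sides send x_i to x_i x_j x_l, or to x_l x_j x_i for the left kind.\<close>

lemma transvection_commutator:
  assumes "i < n" "j < n" "l < n" "i \<noteq> j" "j \<noteq> l" "i \<noteq> l"
  shows "transvection n b j l \<otimes>\<^bsub>Aut n\<^esub> transvection n b i j =
    transvection n b i j \<otimes>\<^bsub>Aut n\<^esub> transvection n b j l \<otimes>\<^bsub>Aut n\<^esub> transvection n b i l"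
  by (rule Aut_eqI) (use assms in \<open>auto simp: Aut_mult_apply Aut_apply_mult transvection_gen Fn.m_assoc\<close>)

text \<open>Different generators are modified, and neither map changes the generator that the other
  multiplies by. The kinds may differ.\<close>

lemma transvection_commute:
  assumes "i < n" "j < n" "i' < n" "j' < n" "i \<noteq> j" "i' \<noteq> j'" "i \<noteq> i'" "i \<noteq> j'" "i' \<noteq> j"
  shows "transvection n b i j \<otimes>\<^bsub>Aut n\<^esub> transvection n b' i' j' =
    transvection n b' i' j' \<otimes>\<^bsub>Aut n\<^esub> transvection n b i j"
  by (rule Aut_eqI) (use assms in \<open>auto simp: Aut_mult_apply Aut_apply_mult transvection_gen\<close>)

lemma transvection_inv_gen:
  assumes "i < n" "j < n" "l < n" "i \<noteq> j"
  shows "(inv\<^bsub>Aut n\<^esub> transvection n b i j) (gen l) =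
    (if l = i then (if b then gen i \<otimes>\<^bsub>Fn n\<^esub> inv\<^bsub>Fn n\<^esub> gen j
     else inv\<^bsub>Fn n\<^esub> gen j \<otimes>\<^bsub>Fn n\<^esub> gen i) else gen l)" (is "_ = ?w")
proof -
  let ?t = "transvection n b i j"
  have "?t ?w = gen l"
    using assms by (auto simp: Aut_apply_mult Aut_apply_inv transvection_gen Fn.m_assoc)
      (simp add: Fn.m_assoc[symmetric])
  moreover have "?w \<in> carrier (Fn n)" using assms by auto
  ultimately show ?thesis
    using Aut_inv_apply(2)[of ?t n ?w] assms by simp
qed

text \<open>If x_i is inverted, then a product containing it is read backwards, which exchanges left
  and right; hence the kind \<open>b = e i\<close>. If the signs of x_i and x_j differ, the
  multiplier appears inverted, hence the inverse transvection.\<close>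

lemma signed_perm_transvection:
  assumes p: "p permutes {..<n}" and "i < n" "j < n" "i \<noteq> j"
  shows "signed_perm n p e \<otimes>\<^bsub>Aut n\<^esub> transvection n b i j =
    (if e i = e j then transvection n (b = e i) (p i) (p j)
     else inv\<^bsub>Aut n\<^esub> transvection n (b = e i) (p i) (p j)) \<otimes>\<^bsub>Aut n\<^esub> signed_perm n p e"
    (is "?s \<otimes>\<^bsub>Aut n\<^esub> ?t = ?t' \<otimes>\<^bsub>Aut n\<^esub> ?s")
proof -
  have pij: "p i < n" "p j < n" "p i \<noteq> p j"
    using assms permutes_lessThan[OF p] permutes_inj[OF p] by (auto simp: inj_eq)
  then have t': "?t' \<in> carrier (Aut n)" by auto
  have l: "[(m, True)] = gen m" "[(m, False)] = inv\<^bsub>Fn n\<^esub> gen m" if "m < n" for m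
    using that by (auto simp: gen_def inv_letter_word)
  show ?thesis
  proof (rule Aut_eqI)
    fix m assume m: "m < n"
    have pm: "p m < n" "p m = p i \<longleftrightarrow> m = i"
      using m permutes_lessThan[OF p] permutes_inj[OF p] by (auto simp: inj_eq)
    show "(?s \<otimes>\<^bsub>Aut n\<^esub> ?t) (gen m) = (?t' \<otimes>\<^bsub>Aut n\<^esub> ?s) (gen m)"
      using assms pij pm m t'
      by (cases "e i"; cases "e j"; cases "e m"; cases b)
        (auto simp: Aut_mult_apply Aut_apply_mult Aut_apply_inv transvection_gen
          transvection_inv_gen signed_perm_gen l Fn.inv_mult_group)
  qed (use assms t' in auto)
qed

section \<open>Cancellation in free groups\<close>

lemma reduced_append:
  "reduced (u @ v) \<longleftrightarrow> reduced u \<and> reduced v \<and> (u = [] \<or> v = [] \<or> hd v \<noteq> inv_letter (last u))"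
  by (auto simp: reduced_def successively_append_iff)

lemma foldr_push_reduced: "reduced (u @ v) \<Longrightarrow> foldr push u v = u @ v"
proof (induction u)
  case (Cons x u)
  then show ?case using reduced_ConsD[of x "u @ v"] push_reduced_Cons[of x "u @ v"] by simp
qed simp

lemma foldr_push_winv: "foldr push (winv p) (p @ b) = b"
  by (induction p) auto

lemma foldr_push_cancel: "reduced (a @ b) \<Longrightarrow> foldr push (a @ winv p) (p @ b) = a @ b"
  by (simp add: foldr_push_winv foldr_push_reduced)

text \<open>The number of letters of \<open>v\<close> lost in the product, which is the Gromov
  product of the inverse of \<open>u\<close> with \<open>v\<close> at the identity. Defined through
  lengths, it does not depend on a chosen decomposition.\<close>

definition cancel_length :: "('a \<times> bool) list \<Rightarrow> ('a \<times> bool) list \<Rightarrow> nat" where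
  "cancel_length u v = (length u + length v - length (foldr push u v)) div 2"

text \<open>Letters are stripped from the end of \<open>u\<close> as long as they are inverse to the
  head of what remains of \<open>v\<close>; the stripped letters of \<open>v\<close> form
  \<open>p\<close>.\<close>

lemma cancellation:
  assumes "reduced u" "reduced v"
  obtains a p b where "u = a @ winv p" "v = p @ b" "reduced (a @ b)" "foldr push u v = a @ b"
    "length p = cancel_length u v"
proof -
  have "\<exists>a p b. u = a @ winv p \<and> v = p @ b \<and> reduced (a @ b)"
    using assms
  proof (induction u arbitrary: v rule: rev_induct)
    case Nil
    then show ?case by (intro exI[of _ "[]"] exI[of _ v]) auto
  next
    case (snoc x u)
    show ?case
    proof (cases "v = [] \<or> hd v \<noteq> inv_letter x")
      case True
      then have "reduced ((u @ [x]) @ v)"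
        using snoc.prems by (subst reduced_append) auto
      then show ?thesis
        by (intro exI[of _ "u @ [x]"] exI[of _ "[]"] exI[of _ v]) auto
    next
      case False
      then obtain v' where v: "v = inv_letter x # v'" by (cases v) auto
      then obtain a p b where "u = a @ winv p" "v' = p @ b" "reduced (a @ b)"
        using snoc.IH[of v'] snoc.prems reduced_ConsD[of _ v'] reduced_append[of u "[x]"] by blast
      then show ?thesis
        using v by (intro exI[of _ a] exI[of _ "inv_letter x # p"] exI[of _ b]) auto
    qed
  qed
  then obtain a p b where *: "u = a @ winv p" "v = p @ b" "reduced (a @ b)" by blast
  have **: "foldr push u v = a @ b" unfolding *(1,2) by (rule foldr_push_cancel[OF *(3)])
  have "length p = cancel_length u v"
    unfolding cancel_length_def ** by (simp add: *(1,2))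
  with * ** show ?thesis by (rule that)
qed

text \<open>If half of \<open>w\<close> or more cancelled in the product of \<open>w\<close> with
  itself, letters in mirror positions next to the middle would be mutually inverse. For odd length
  the middle letter would be its own inverse; for even length the two middle letters would
  cancel.\<close>

lemma cancel_length_self:
  assumes "reduced w" "w \<noteq> []"
  shows "2 * cancel_length w w < length w"
proof (rule ccontr)
  assume "\<not> ?thesis"
  moreover obtain a p b where w: "w = a @ winv p" "w = p @ b" "length p = cancel_length w w"
    using cancellation[OF assms(1) assms(1)] by metis
  ultimately have le: "length w \<le> 2 * length p" by simp
  define i where "i = (length w - 1) div 2"
  have "0 < length w" using assms(2) by simp
  then have i: "i < length p" using le unfolding i_def by linarith
  have la: "length w = length a + length p" using arg_cong[OF w(1), of length] by simp
  have "length w - 1 - i = length a + (length p - 1 - i)" using i la by simp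
  then have "w ! (length w - 1 - i) = winv p ! (length p - 1 - i)"
    using w(1) nth_append_length_plus by metis
  also have "\<dots> = inv_letter (p ! i)" using i by (simp add: rev_nth)
  also have "p ! i = w ! i" by (subst w(2)) (use i in \<open>simp add: nth_append\<close>)
  finally have eq: "w ! (length w - 1 - i) = inv_letter (w ! i)" .
  show False
  proof (cases "odd (length w)")
    case True
    then have "length w - 1 - i = i" by (auto simp: i_def elim!: oddE)
    then show False using eq by simp
  next
    case False
    then obtain c where "length w = 2 * Suc c"
      using \<open>0 < length w\<close> by (metis evenE not0_implies_Suc mult_0_right less_not_refl)
    then have *: "length w - 1 - i = Suc i" "Suc i < length w"
      by (simp_all add: i_def)
    then have "w ! Suc i \<noteq> inv_letter (w ! i)"
      using assms(1) successively_nth[of _ w i] unfolding reduced_def by blast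
    then show False using eq * by simp
  qed
qed

text \<open>The tie-breaker between words of equal length in the Nielsen reduction.\<close>

fun word_value :: "nat \<Rightarrow> (nat \<times> bool) list \<Rightarrow> nat" where
  "word_value B [] = 0"
| "word_value B (x # w) = (2 * fst x + of_bool (snd x)) * B ^ length w + word_value B w"

lemma word_value_append:
  "word_value B (u @ v) = word_value B u * B ^ length v + word_value B v"
  by (induction u) (auto simp: algebra_simps power_add)

text \<open>The 2n letters are numbered by \<open>2 * fst x + of_bool (snd x)\<close>, so a word is
  a numeral in base 2n.\<close>

lemma word_value_less:
  assumes "fst ` set w \<subseteq> {..<n}"
  shows "word_value (2 * n) w < (2 * n) ^ length w"
  using assms
proof (induction w)
  case (Cons x w)
  have "2 * fst x + of_bool (snd x) + 1 \<le> 2 * n"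
    using Cons.prems by (cases "snd x") auto
  then have "(2 * fst x + of_bool (snd x) + 1) * (2 * n) ^ length w \<le> 2 * n * (2 * n) ^ length w"
    by (rule mult_right_mono) simp
  moreover have "word_value (2 * n) w < (2 * n) ^ length w" using Cons by simp
  ultimately show ?case by (simp add: algebra_simps)
qed simp

lemma word_value_inj:
  assumes "length u = length v" "fst ` set u \<subseteq> {..<n}" "fst ` set v \<subseteq> {..<n}"
    and "word_value (2 * n) u = word_value (2 * n) v"
  shows "u = v"
  using assms
proof (induction u v rule: list_induct2)
  case (Cons x u y v)
  let ?d = "\<lambda>x. 2 * fst x + of_bool (snd x) :: nat" and ?N = "(2 * n) ^ length u"
  have less: "word_value (2 * n) u < ?N" "word_value (2 * n) v < ?N"
    using word_value_less[of u n] word_value_less[of v n] Cons by auto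
  have eq: "?d x * ?N + word_value (2 * n) u = ?d y * ?N + word_value (2 * n) v"
    using Cons.prems(3) Cons.hyps by simp
  have digit: "d * N + r = d' * N + r' \<Longrightarrow> r < N \<Longrightarrow> r' < N \<Longrightarrow> d = d' \<and> r = r'"
    for d d' r r' N :: nat
    by (metis add.commute div_mult_self1 div_less add_0 add_left_imp_eq less_nat_zero_code)
  have "?d x = ?d y" "word_value (2 * n) u = word_value (2 * n) v"
    using digit[OF eq less] by blast+
  moreover from \<open>?d x = ?d y\<close> have "x = y"
    by (cases "snd x"; cases "snd y") (auto simp: prod_eq_iff, presburger+)
  ultimately show ?case using Cons by auto
qed simp

definition half :: "'a list \<Rightarrow> 'a list" where
  "half w = take ((length w + 1) div 2) w"

text \<open>The images of the generators matter only up to inversion, so the value must be symmetric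
  in \<open>w\<close> and its inverse. Taking initial halves, rounded up, lets a change in the first
  half of \<open>w\<close> go unseen by the half of the inverse.\<close>

definition half_value :: "nat \<Rightarrow> (nat \<times> bool) list \<Rightarrow> nat" where
  "half_value B w = word_value B (half w) + word_value B (half (winv w))"

lemma winv_winv: "winv (winv w) = w"
  by (simp add: rev_map comp_def)

lemma half_value_winv [simp]: "half_value B (winv w) = half_value B w"
  by (simp add: half_value_def winv_winv)

text \<open>Since \<open>t\<close> is at least as long as the prefix, the initial halves of the
  inverses coincide, and the initial halves of the words contain the prefixes followed by the same
  part of \<open>t\<close>. Only the prefixes are left to compare.\<close>

lemma half_value_prefix_le:
  assumes "half_value B (p @ t) \<le> half_value B (q @ t)" "length p = length q" "length p \<le> length t"
    "B > 0"
  shows "word_value B p \<le> word_value B q"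
proof -
  let ?h = "(length p + length t + 1) div 2"
  have h: "length p \<le> ?h" "?h \<le> length t" using assms(3) by auto
  have half: "half (r @ t) = r @ take (?h - length p) t" "half (winv (r @ t)) = take ?h (winv t)"
    if "length r = length p" for r
    using h that by (auto simp: half_def add.commute)
  have "word_value B p * B ^ (?h - length p) \<le> word_value B q * B ^ (?h - length p)"
    using assms(1) half[of p] half[of q] assms(2) h
    by (simp add: half_value_def word_value_append min_def split: if_splits)
  then show ?thesis using assms(4) by simp
qed

section \<open>Nielsen reduction\<close>

definition nielsen_measure :: "nat \<Rightarrow> ((nat \<times> bool) list \<Rightarrow> (nat \<times> bool) list) \<Rightarrow> nat \<times> nat" where
  "nielsen_measure n \<phi> =
     (\<Sum>i<n. length (\<phi> (gen i)), \<Sum>i<n. half_value (2 * n) (\<phi> (gen i)))"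

text \<open>Minimality under a single move is all that the reduction uses. The factor \<tau> stands
  on the right and is applied first, so it replaces \<phi>(x_i) by its product with \<phi>(x_j) or
  the inverse of \<phi>(x_j).\<close>

definition nielsen_minimal :: "nat \<Rightarrow> ((nat \<times> bool) list \<Rightarrow> (nat \<times> bool) list) \<Rightarrow> bool" where
  "nielsen_minimal n \<phi> \<longleftrightarrow> \<phi> \<in> carrier (Aut n) \<and>
     (\<forall>b i j \<tau>. i < n \<longrightarrow> j < n \<longrightarrow> i \<noteq> j \<longrightarrow>
        \<tau> \<in> {transvection n b i j, inv\<^bsub>Aut n\<^esub> transvection n b i j} \<longrightarrow>
        (nielsen_measure n (\<phi> \<otimes>\<^bsub>Aut n\<^esub> \<tau>), nielsen_measure n \<phi>) \<notin> less_than <*lex*> less_than)"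

lemma nielsen_minimal_exists:
  assumes H: "subgroup H (Aut n)"
    and tv: "\<And>b i j. i < n \<Longrightarrow> j < n \<Longrightarrow> i \<noteq> j \<Longrightarrow> transvection n b i j \<in> H"
    and \<phi>: "\<phi> \<in> carrier (Aut n)"
  obtains \<gamma> where "\<gamma> \<in> H" "nielsen_minimal n (\<phi> \<otimes>\<^bsub>Aut n\<^esub> \<gamma>)"
proof -
  let ?R = "inv_image (less_than <*lex*> less_than) (\<lambda>\<gamma>. nielsen_measure n (\<phi> \<otimes>\<^bsub>Aut n\<^esub> \<gamma>))"
  have "wf ?R" by auto
  moreover have "\<one>\<^bsub>Aut n\<^esub> \<in> H" using subgroup.one_closed[OF H] .
  ultimately obtain \<gamma> where \<gamma>: "\<gamma> \<in> H" and min: "\<And>\<gamma>'. (\<gamma>', \<gamma>) \<in> ?R \<Longrightarrow> \<gamma>' \<notin> H"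
    using wfE_min by metis
  have \<gamma>c: "\<gamma> \<in> carrier (Aut n)" using \<gamma> subgroup.subset[OF H] by blast
  show ?thesis
  proof
    show "nielsen_minimal n (\<phi> \<otimes>\<^bsub>Aut n\<^esub> \<gamma>)"
      unfolding nielsen_minimal_def
    proof (intro conjI allI impI notI)
      fix b i j \<tau>
      assume ij: "i < n" "j < n" "i \<noteq> j"
        and \<tau>: "\<tau> \<in> {transvection n b i j, inv\<^bsub>Aut n\<^esub> transvection n b i j}"
        and less: "(nielsen_measure n (\<phi> \<otimes>\<^bsub>Aut n\<^esub> \<gamma> \<otimes>\<^bsub>Aut n\<^esub> \<tau>),
          nielsen_measure n (\<phi> \<otimes>\<^bsub>Aut n\<^esub> \<gamma>)) \<in> less_than <*lex*> less_than"
      have "\<tau> \<in> H" using \<tau> tv[OF ij] subgroup.m_inv_closed[OF H] by blast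
      then have "\<gamma> \<otimes>\<^bsub>Aut n\<^esub> \<tau> \<in> H" "\<tau> \<in> carrier (Aut n)"
        using \<gamma> subgroup.m_closed[OF H] subgroup.subset[OF H] by blast+
      then show False using min less \<phi> \<gamma>c by (simp add: Aut.m_assoc)
    qed (use \<phi> \<gamma>c in simp)
  qed (rule \<gamma>)
qed

section \<open>Words never shrink under a Nielsen minimal automorphism\<close>

context
  fixes n \<phi>
  assumes minimal: "nielsen_minimal n \<phi>"
begin

lemma minimal_in_Aut: "\<phi> \<in> carrier (Aut n)"
  using minimal by (simp add: nielsen_minimal_def)

private lemma in_Fn: "fst l < n \<Longrightarrow> \<phi> [l] \<in> carrier (Fn n)"
  using minimal_in_Aut by (cases l) simp

private lemma red: "fst l < n \<Longrightarrow> reduced (\<phi> [l])"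
  using in_Fn by (simp add: free_group_simps)

private lemma letters: "fst l < n \<Longrightarrow> fst ` set (\<phi> [l]) \<subseteq> {..<n}"
  using in_Fn by (simp add: free_group_simps)

private lemma nonempty: "fst l < n \<Longrightarrow> \<phi> [l] \<noteq> []"
proof
  assume l: "fst l < n" and "\<phi> [l] = []"
  moreover have "\<phi> [] = []"
    using group_hom.hom_one[OF Aut_group_hom[OF minimal_in_Aut]] by (simp add: free_group_simps)
  moreover have "[] \<in> carrier (Fn n)" by (simp add: free_group_simps)
  ultimately have "[l] = []"
    using Aut_apply_inj[OF minimal_in_Aut, of "[l]" "[]"] by (cases l) simp
  then show False by simp
qed

private lemma inv_letter_value: "fst l < n \<Longrightarrow> \<phi> [inv_letter l] = winv (\<phi> [l])"
  using Aut_apply_inv[OF minimal_in_Aut, of "[l]"] in_Fn[of l] inv_letter_word[of "fst l" n "snd l"]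
  by (cases l) (simp add: inv_free_group inv_letter_def)

text \<open>Up to inversion, passing from \<open>\<phi> [l]\<close> to \<open>w\<close> is one move.
  If \<open>l\<close> is an inverse letter, then the inverse of \<open>w\<close> is a left multiple
  of \<phi>(x_i); hence the kind is \<open>e\<close>, and the transvection itself or its inverse
  occurs according to \<open>d = e\<close>. Both measures ignore inversion, so only the summand at
  \<open>i\<close> changes.\<close>

private lemma replace_left:
  assumes l: "fst l < n" and m: "fst m < n" and neq: "fst l \<noteq> fst m"
  defines "w \<equiv> \<phi> [l] \<otimes>\<^bsub>Fn n\<^esub> \<phi> [m]"
  shows "length (\<phi> [l]) \<le> length w \<and>
    (length (\<phi> [l]) = length w \<longrightarrow> half_value (2 * n) (\<phi> [l]) \<le> half_value (2 * n) w)"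
proof -
  obtain i e j d where lm: "l = (i, e)" "m = (j, d)" by (cases l; cases m)
  then have ij: "i < n" "j < n" "i \<noteq> j" using l m neq by auto
  let ?\<tau> = "if d = e then transvection n e i j else inv\<^bsub>Aut n\<^esub> transvection n e i j"
  let ?\<psi> = "\<phi> \<otimes>\<^bsub>Aut n\<^esub> ?\<tau>"
  have \<phi>: "\<phi> \<in> carrier (Aut n)" by (rule minimal_in_Aut)
  have \<tau>: "?\<tau> \<in> carrier (Aut n)" using ij by auto
  have letter: "\<phi> [(i, e)] = (if e then \<phi> (gen i) else inv\<^bsub>Fn n\<^esub> \<phi> (gen i))"
    "\<phi> [(j, d)] = (if d then \<phi> (gen j) else inv\<^bsub>Fn n\<^esub> \<phi> (gen j))"
    using Aut_apply_letter[OF \<phi>] ij by blast+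
  have w: "w \<in> carrier (Fn n)" using in_Fn l m by (simp add: w_def)
  have at_i: "?\<psi> (gen i) = (if e then w else inv\<^bsub>Fn n\<^esub> w)"
    unfolding Aut_mult_apply[OF \<phi> \<tau> gen_in_Fn[THEN iffD2, OF ij(1)]] w_def lm letter
    using ij \<phi> by (cases e; cases d) (simp_all add: transvection_gen transvection_inv_gen
      Aut_apply_mult Aut_apply_inv Fn.inv_mult_group)
  have other: "?\<psi> (gen x) = \<phi> (gen x)" if "x < n" "x \<noteq> i" for x
    unfolding Aut_mult_apply[OF \<phi> \<tau> gen_in_Fn[THEN iffD2, OF that(1)]]
    using ij that by (simp add: transvection_gen transvection_inv_gen)
  have sum: "(\<Sum>x<n. f (?\<psi> (gen x))) + f (\<phi> [l]) = (\<Sum>x<n. f (\<phi> (gen x))) + f w"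
    if f: "\<And>u. f (winv u) = f u" for f :: "(nat \<times> bool) list \<Rightarrow> nat"
  proof -
    have "f (?\<psi> (gen i)) = f w"
      unfolding at_i using f w by (simp add: inv_free_group)
    moreover have "f (\<phi> [l]) = f (\<phi> (gen i))"
      unfolding lm letter using f \<phi> ij by (simp add: inv_free_group)
    moreover have "(\<Sum>x\<in>{..<n} - {i}. f (?\<psi> (gen x))) = (\<Sum>x\<in>{..<n} - {i}. f (\<phi> (gen x)))"
      using other by (intro sum.cong) auto
    ultimately show ?thesis
      using sum.remove[of "{..<n}" i "\<lambda>x. f (?\<psi> (gen x))"]
        sum.remove[of "{..<n}" i "\<lambda>x. f (\<phi> (gen x))"] ij by simp
  qed
  have "(nielsen_measure n ?\<psi>, nielsen_measure n \<phi>) \<notin> less_than <*lex*> less_than"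
    using minimal ij unfolding nielsen_minimal_def by auto
  then show ?thesis
    using sum[of length] sum[of "half_value (2 * n)"] by (auto simp: nielsen_measure_def)
qed

text \<open>Inversion reverses the two factors and is invisible to both measures, so this is
  \<open>replace_left\<close> for the inverse letters.\<close>

private lemma replace_right:
  assumes l: "fst l < n" and m: "fst m < n" and neq: "fst l \<noteq> fst m"
  defines "w \<equiv> \<phi> [l] \<otimes>\<^bsub>Fn n\<^esub> \<phi> [m]"
  shows "length (\<phi> [m]) \<le> length w \<and>
    (length (\<phi> [m]) = length w \<longrightarrow> half_value (2 * n) (\<phi> [m]) \<le> half_value (2 * n) w)"
proof -
  have "\<phi> [inv_letter m] \<otimes>\<^bsub>Fn n\<^esub> \<phi> [inv_letter l] = inv\<^bsub>Fn n\<^esub> w"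
    using in_Fn[OF l] in_Fn[OF m]
    by (simp add: w_def inv_letter_value l m Fn.inv_mult_group inv_free_group[symmetric])
  also have "\<dots> = winv w" using in_Fn l m by (simp add: w_def inv_free_group)
  finally show ?thesis
    using replace_left[of "inv_letter m" "inv_letter l"] l m neq by (simp add: inv_letter_value)
qed

text \<open>If more than half of one factor cancelled, the product would be shorter than the other
  factor and could replace it. When both letters belong to the same generator no transvection is
  available; then \<open>l = m\<close> and \<open>cancel_length_self\<close> applies.\<close>

private lemma cancel_le:
  assumes l: "fst l < n" and m: "fst m < n" and neq: "m \<noteq> inv_letter l"
  shows "2 * cancel_length (\<phi> [l]) (\<phi> [m]) \<le> length (\<phi> [l])"
    and "2 * cancel_length (\<phi> [l]) (\<phi> [m]) \<le> length (\<phi> [m])"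
proof -
  have "2 * cancel_length (\<phi> [l]) (\<phi> [m]) \<le> length (\<phi> [l]) \<and>
        2 * cancel_length (\<phi> [l]) (\<phi> [m]) \<le> length (\<phi> [m])"
  proof (cases "fst l = fst m")
    case True
    then have "l = m" using neq by (cases l; cases m) (auto simp: inv_letter_def)
    then show ?thesis using cancel_length_self[OF red[OF l] nonempty[OF l]] by simp
  next
    case False
    obtain a p b where *: "\<phi> [l] = a @ winv p" "\<phi> [m] = p @ b" "reduced (a @ b)"
      "foldr push (\<phi> [l]) (\<phi> [m]) = a @ b" "length p = cancel_length (\<phi> [l]) (\<phi> [m])"
      by (rule cancellation[OF red[OF l] red[OF m]])
    have "length (\<phi> [l]) = length a + length p" "length (\<phi> [m]) = length p + length b"
      using arg_cong[OF *(1), of length] arg_cong[OF *(2), of length] by simp_all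
    moreover have "length (\<phi> [l]) \<le> length a + length b" "length (\<phi> [m]) \<le> length a + length b"
      using replace_left[OF l m False] replace_right[OF l m False] *(4)
      by (simp_all add: free_group_simps)
    ultimately show ?thesis using *(5) by simp
  qed
  then show "2 * cancel_length (\<phi> [l]) (\<phi> [m]) \<le> length (\<phi> [l])"
    "2 * cancel_length (\<phi> [l]) (\<phi> [m]) \<le> length (\<phi> [m])" by auto
qed

text \<open>Otherwise exactly half of \<open>\<phi> [m]\<close> cancels on each side, so
  \<open>\<phi> [m]\<close> is \<open>p\<close> followed by the inverse of \<open>q\<close>, with p
  and q of equal length. Replacing the left neighbour exchanges \<open>p\<close> for
  \<open>q\<close>, replacing the right one exchanges \<open>q\<close> for \<open>p\<close>, and
  neither changes a length. The tie-breaker bounds the values of both by each other, so p = q and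
  \<open>\<phi> [m]\<close> would not be reduced.\<close>

private lemma cancel_less:
  assumes l: "fst l < n" and m: "fst m < n" and r: "fst r < n"
    and lm: "m \<noteq> inv_letter l" and mr: "r \<noteq> inv_letter m"
  shows "cancel_length (\<phi> [l]) (\<phi> [m]) + cancel_length (\<phi> [m]) (\<phi> [r]) < length (\<phi> [m])"
proof (rule ccontr)
  assume "\<not> ?thesis"
  then have half: "2 * cancel_length (\<phi> [l]) (\<phi> [m]) = length (\<phi> [m])"
    "2 * cancel_length (\<phi> [m]) (\<phi> [r]) = length (\<phi> [m])"
    using cancel_le[OF l m lm] cancel_le[OF m r mr] by linarith+
  have "l \<noteq> m" "m \<noteq> r"
    using half cancel_length_self[OF red[OF m] nonempty[OF m]] by auto
  then have neq: "fst l \<noteq> fst m" "fst m \<noteq> fst r"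
    using lm mr by (cases l; cases m; cases r; auto simp: inv_letter_def)+
  obtain a p b where 1: "\<phi> [l] = a @ winv p" "\<phi> [m] = p @ b" "reduced (a @ b)"
    "foldr push (\<phi> [l]) (\<phi> [m]) = a @ b" "length p = cancel_length (\<phi> [l]) (\<phi> [m])"
    by (rule cancellation[OF red[OF l] red[OF m]])
  obtain a' q c where 2: "\<phi> [m] = a' @ winv q" "\<phi> [r] = q @ c" "reduced (a' @ c)"
    "foldr push (\<phi> [m]) (\<phi> [r]) = a' @ c" "length q = cancel_length (\<phi> [m]) (\<phi> [r])"
    by (rule cancellation[OF red[OF m] red[OF r]])
  have lens: "length (\<phi> [m]) = length p + length b" "length (\<phi> [m]) = length a' + length q"
    "length (\<phi> [l]) = length a + length p" "length (\<phi> [r]) = length q + length c"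
    using arg_cong[OF 1(2), of length] arg_cong[OF 2(1), of length]
      arg_cong[OF 1(1), of length] arg_cong[OF 2(2), of length] by simp_all
  have pq: "length p = length q" "length a' = length p" "length p \<le> length a" "length q \<le> length c"
    using half lens 1(5) 2(5) cancel_le[OF l m lm] cancel_le[OF m r mr] by linarith+
  have "p @ b = a' @ winv q" using 1(2) 2(1) by simp
  then have b: "b = winv q" and a': "a' = p" using pq(2) by auto
  have B: "2 * n > 0" using l by simp
  have "half_value (2 * n) (a @ winv p) \<le> half_value (2 * n) (a @ winv q)"
    using replace_left[OF l m neq(1)] 1 b pq lens by (simp add: free_group_simps)
  then have "half_value (2 * n) (winv (a @ winv p)) \<le> half_value (2 * n) (winv (a @ winv q))"
    by (simp only: half_value_winv)
  then have "half_value (2 * n) (p @ winv a) \<le> half_value (2 * n) (q @ winv a)"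
    by (simp add: winv_winv[simplified])
  then have "word_value (2 * n) p \<le> word_value (2 * n) q"
    by (rule half_value_prefix_le) (use pq B in auto)
  moreover have "half_value (2 * n) (q @ c) \<le> half_value (2 * n) (p @ c)"
    using replace_right[OF m r neq(2)] 2 a' pq lens by (simp add: free_group_simps)
  then have "word_value (2 * n) q \<le> word_value (2 * n) p"
    by (rule half_value_prefix_le) (use pq B in auto)
  moreover have "fst ` set p \<subseteq> {..<n}" "fst ` set q \<subseteq> {..<n}"
    using letters[OF m] letters[OF r] 1(2) 2(2) by auto
  ultimately have "p = q" using pq word_value_inj[of p q n] by simp
  then have "\<phi> [m] = p @ winv p" using 1(2) b by simp
  moreover have "p \<noteq> []" using calculation nonempty[OF m] by auto
  moreover have "hd (winv p) = inv_letter (last p)" using \<open>p \<noteq> []\<close> by (simp add: hd_map hd_rev)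
  ultimately show False using red[OF m] reduced_append[of p "winv p"] by auto
qed

text \<open>The invariant of reading a reduced word letter by letter: the image of the last letter
  survives in a suffix \<open>t\<close> that the next cancellation cannot exhaust. Hence each
  earlier letter has left at least one letter in \<open>s\<close>.\<close>

private lemma length_apply_snoc:
  assumes "w @ [m] \<in> carrier (Fn n)"
  shows "\<exists>s r t. \<phi> (w @ [m]) = s @ t \<and> \<phi> [m] = r @ t \<and> length w \<le> length s \<and> t \<noteq> [] \<and>
    (\<forall>m'. fst m' < n \<longrightarrow> m' \<noteq> inv_letter m \<longrightarrow> cancel_length (\<phi> [m]) (\<phi> [m']) < length t)"
  using assms
proof (induction w arbitrary: m rule: rev_induct)
  case Nil
  then have m: "fst m < n" by (simp add: free_group_simps)
  have "cancel_length (\<phi> [m]) (\<phi> [m']) < length (\<phi> [m])" if "fst m' < n" "m' \<noteq> inv_letter m" for m'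
    using cancel_le(1)[OF m that] nonempty[OF m] by (cases "\<phi> [m]") auto
  then show ?case using nonempty[OF m] by (intro exI[of _ "[]"] exI[of _ "\<phi> [m]"]) auto
next
  case (snoc l w)
  have lm: "fst l < n" "fst m < n" "m \<noteq> inv_letter l" "w @ [l] \<in> carrier (Fn n)"
    using snoc.prems reduced_append[of w "[l, m]"] reduced_append[of "w @ [l]" "[m]"]
    by (auto simp: free_group_simps reduced_def)
  obtain s r t where IH: "\<phi> (w @ [l]) = s @ t" "\<phi> [l] = r @ t" "length w \<le> length s" "t \<noteq> []"
    "cancel_length (\<phi> [l]) (\<phi> [m]) < length t"
    using snoc.IH[OF lm(4)] lm(2,3) by blast
  obtain a p b where *: "\<phi> [l] = a @ winv p" "\<phi> [m] = p @ b" "reduced (a @ b)"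
    "foldr push (\<phi> [l]) (\<phi> [m]) = a @ b" "length p = cancel_length (\<phi> [l]) (\<phi> [m])"
    by (rule cancellation[OF red[OF lm(1)] red[OF lm(2)]])
  have "r @ t = a @ winv p" using IH(2) *(1) by simp
  \<comment> \<open>The cancelled piece is shorter than \<open>t\<close>, so the cut falls inside
    \<open>t\<close>. The surviving part \<open>t'\<close> is nonempty and shields \<open>s\<close>
    from the new factor.\<close>
  then obtain t' where "(r = a @ t' \<and> t' @ t = winv p) \<or> (r @ t' = a \<and> t = t' @ winv p)"
    unfolding append_eq_append_conv2 by blast
  moreover have "t' @ t \<noteq> winv p"
    using IH(5) *(5) by (auto dest: arg_cong[of _ _ length])
  ultimately have t': "t = t' @ winv p" "a = r @ t'" by auto
  have "t' \<noteq> []" using t' IH(5) *(5) by auto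
  have b: "length (\<phi> [m]) = length p + length b" using arg_cong[OF *(2), of length] by simp
  have b': "b \<noteq> []"
    using cancel_le(2)[OF lm(1,2,3)] b *(5) nonempty[OF lm(2)] *(2) by auto
  have "reduced (s @ t)" using IH(1) Aut_apply_closed[OF minimal_in_Aut lm(4)]
    by (simp add: free_group_simps)
  then have "reduced (s @ t')" unfolding t' using reduced_append[of "s @ t'" "winv p"] by simp
  moreover have "reduced (t' @ b)" using *(3) t'(2) reduced_append[of r "t' @ b"] by simp
  ultimately have "reduced ((s @ t') @ b)"
    using \<open>t' \<noteq> []\<close> reduced_append[of "s @ t'" b] reduced_append[of t' b] by auto
  moreover have "\<phi> ((w @ [l]) @ [m]) = \<phi> (w @ [l]) \<otimes>\<^bsub>Fn n\<^esub> \<phi> [m]"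
  proof -
    have "(w @ [l]) @ [m] = (w @ [l]) \<otimes>\<^bsub>Fn n\<^esub> [m]"
      using snoc.prems foldr_push_reduced[of "w @ [l]" "[m]"] by (simp add: free_group_simps)
    moreover have "[m] \<in> carrier (Fn n)" using lm(2) by (cases m) simp
    ultimately show ?thesis using Aut_apply_mult[OF minimal_in_Aut lm(4)] by simp
  qed
  ultimately have "\<phi> ((w @ [l]) @ [m]) = (s @ t') @ b"
    using foldr_push_cancel[of "s @ t'" b p] IH(1) *(2) t'(1) by (simp add: free_group_simps)
  moreover have "length (w @ [l]) \<le> length (s @ t')" using IH(3) \<open>t' \<noteq> []\<close> by (cases t') auto
  moreover have "cancel_length (\<phi> [m]) (\<phi> [m']) < length b"
    if "fst m' < n" "m' \<noteq> inv_letter m" for m'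
    using cancel_less[OF lm(1,2) that(1) lm(3) that(2)] b *(5) by linarith
  ultimately show ?case using *(2) b' by blast
qed

lemma nielsen_minimal_length_le:
  assumes "w \<in> carrier (Fn n)"
  shows "length w \<le> length (\<phi> w)"
proof (cases w rule: rev_cases)
  case (snoc v m)
  then obtain s r t where "\<phi> w = s @ t" "length v \<le> length s" "t \<noteq> []"
    using length_apply_snoc[of v m] assms by blast
  then show ?thesis using snoc by (cases t) auto
qed simp

end

text \<open>The word \<phi>^-1(x_i) is sent by \<phi> to a word of length one, and \<phi> does not
  shorten words, so it is a single letter. Two such letters over the same generator would have equal
  or inverse images under \<phi>, which gives injectivity of \<open>p\<close>.\<close>

lemma nielsen_minimal_inverse_signed_perm:
  assumes "nielsen_minimal n \<phi>"
  obtains p e where "p permutes {..<n}" "inv\<^bsub>Aut n\<^esub> \<phi> = signed_perm n p e"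
proof -
  let ?\<psi> = "inv\<^bsub>Aut n\<^esub> \<phi>"
  have \<phi>: "\<phi> \<in> carrier (Aut n)" using minimal_in_Aut[OF assms] .
  then have \<psi>: "?\<psi> \<in> carrier (Aut n)" by simp
  have "\<exists>l. ?\<psi> (gen i) = [l] \<and> fst l < n" if i: "i < n" for i
  proof -
    have c: "?\<psi> (gen i) \<in> carrier (Fn n)" using \<psi> i by simp
    have "length (?\<psi> (gen i)) \<le> 1"
      using nielsen_minimal_length_le[OF assms c] Aut_inv_apply(1)[OF \<phi>, of "gen i"] i
      by (simp add: gen_def)
    moreover have "?\<psi> (gen i) \<noteq> []"
    proof
      assume "?\<psi> (gen i) = []"
      then have "gen i = \<phi> []" using Aut_inv_apply(1)[OF \<phi>, of "gen i"] i by simp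
      moreover have "\<phi> [] = []"
        using group_hom.hom_one[OF Aut_group_hom[OF \<phi>]] by (simp add: free_group_simps)
      ultimately show False by (simp add: gen_def)
    qed
    ultimately obtain l where "?\<psi> (gen i) = [l]"
      by (cases "?\<psi> (gen i)") (auto simp: le_Suc_eq)
    then show ?thesis using c by (auto simp: free_group_simps)
  qed
  then obtain f where f: "\<And>i. i < n \<Longrightarrow> ?\<psi> (gen i) = [f i] \<and> fst (f i) < n" by metis
  define p where "p i = (if i < n then fst (f i) else i)" for i
  have "inj_on p {..<n}"
  proof (rule inj_onI)
    fix i j assume ij: "i \<in> {..<n}" "j \<in> {..<n}" "p i = p j"
    have eq: "[(i, True)] = \<phi> [f i]" "[(j, True)] = \<phi> [f j]"
      using ij f Aut_inv_apply(1)[OF \<phi>] gen_in_Fn by (metis gen_def lessThan_iff)+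
    have "f i = f j \<or> f i = inv_letter (f j)"
      using ij by (cases "f i"; cases "f j") (auto simp: p_def inv_letter_def)
    moreover have "\<phi> [inv_letter (f j)] = [(j, False)]"
      using Aut_apply_inv[OF \<phi>, of "[f j]"] f[of j] ij inv_letter_word[of "fst (f j)" n "snd (f j)"]
        inv_letter_word[of j n True] eq(2)
      by (cases "f j") (simp add: inv_letter_def)
    ultimately show "i = j" using eq by (metis Pair_inject list.inject)
  qed
  moreover have "p ` {..<n} \<subseteq> {..<n}" using f by (auto simp: p_def)
  ultimately have "bij_betw p {..<n} {..<n}"
    by (simp add: bij_betw_def endo_inj_surj)
  then have p: "p permutes {..<n}"
    by (rule bij_imp_permutes) (simp add: p_def)
  have "?\<psi> = signed_perm n p (\<lambda>i. snd (f i))"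
    by (rule Aut_eqI) (use f \<psi> p in \<open>auto simp: signed_perm_gen p_def\<close>)
  then show ?thesis using p that by blast
qed

section \<open>Determinants\<close>

lemma Aut_plus_carrierD: "\<phi> \<in> carrier (Aut_plus n) \<Longrightarrow> \<phi> \<in> carrier (Aut n)"
  by (simp add: Aut_plus_def)

lemma Aut_plus_iff: "\<phi> \<in> carrier (Aut_plus n) \<longleftrightarrow> \<phi> \<in> carrier (Aut n) \<and> det (abel_mat n \<phi>) = 1"
  by (simp add: Aut_plus_def SL_def)

lemma abel_mat_index:
  "i < n \<Longrightarrow> j < n \<Longrightarrow> abel_mat n \<phi> $$ (i, j) = exponent_sum i (\<phi> (gen j))"
  by (simp add: abel_mat_def mat_of_cols_def abel_def)

lemma abel_mat_dim [simp]: "dim_row (abel_mat n \<phi>) = n" "dim_col (abel_mat n \<phi>) = n"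
  by (rule carrier_matD[OF abel_mat_carrier])+

lemma exponent_sum_gen [simp]: "exponent_sum i (gen j) = of_bool (i = j)"
  by (auto simp: gen_def)

lemma exponent_sum_Fn_mult [simp]:
  "exponent_sum i (u \<otimes>\<^bsub>Fn n\<^esub> v) = exponent_sum i u + exponent_sum i v"
  by (simp add: free_group_simps exponent_sum_mult)

lemma transvection_in_Aut_plus [simp]:
  assumes "i < n" "j < n" "i \<noteq> j"
  shows "transvection n b i j \<in> carrier (Aut_plus n)"
proof -
  have "abel_mat n (transvection n b i j) = addrow_mat n 1 j i"
    by (rule eq_matI) (use assms in \<open>auto simp: abel_mat_index transvection_gen addrow_mat_def\<close>)
  then show ?thesis
    using assms det_addrow_mat[of j i n "1::int"] by (simp add: Aut_plus_iff)
qed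

text \<open>The matrix is the diagonal matrix of signs with its rows permuted by the inverse of
  \<open>p\<close>, which has the same sign as \<open>p\<close>.\<close>

lemma det_signed_perm:
  assumes p: "p permutes {..<n}"
  shows "det (abel_mat n (signed_perm n p e)) = sign p * (\<Prod>i<n. if e i then 1 else -1)"
proof -
  let ?q = "inv_into UNIV p"
  let ?s = "\<lambda>i. if e i then 1 else -1 :: int"
  define D where "D = mat n n (\<lambda>(i, j). if i = j then ?s j else 0)"
  have q: "?q permutes {0..<n}" using permutes_inv[OF p] by (simp add: atLeast0LessThan)
  have iff: "?q i = j \<longleftrightarrow> i = p j" for i j using p permutes_inv_eq by metis
  have "abel_mat n (signed_perm n p e) = mat n n (\<lambda>(i, j). D $$ (?q i, j))"
  proof (rule eq_matI)
    fix i j assume "i < dim_row (mat n n (\<lambda>(i, j). D $$ (?q i, j)))"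
      "j < dim_col (mat n n (\<lambda>(i, j). D $$ (?q i, j)))"
    then have ij: "i < n" "j < n" by auto
    have "?q i < n" using q ij permutes_in_image[OF q, of i] by simp
    then show "abel_mat n (signed_perm n p e) $$ (i, j) = mat n n (\<lambda>(i, j). D $$ (?q i, j)) $$ (i, j)"
      using ij p by (simp add: abel_mat_index signed_perm_gen D_def iff)
  qed auto
  moreover have "D \<in> carrier_mat n n" by (simp add: D_def)
  ultimately have "det (abel_mat n (signed_perm n p e)) = sign ?q * det D"
    using det_permute_rows[OF _ q, of D] by simp
  moreover have "sign ?q = sign p"
    using sign_inverse[of p] p permutation_permutes[of p] by (metis finite_lessThan)
  moreover have "det D = (\<Prod>i<n. ?s i)"
  proof -
    have "det D = prod_list (diag_mat D)"
      by (rule det_upper_triangular[where n = n]) (auto simp: D_def)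
    also have "\<dots> = (\<Prod>i<n. ?s i)"
      by (simp add: diag_mat_def D_def prod.distinct_set_conv_list[symmetric] atLeast0LessThan
          cong: map_cong)
    finally show ?thesis .
  qed
  ultimately show ?thesis by simp
qed

lemma signed_perm_mult:
  assumes "p permutes {..<n}" "q permutes {..<n}"
  shows "signed_perm n p d \<otimes>\<^bsub>Aut n\<^esub> signed_perm n q e =
    signed_perm n (p \<circ> q) (\<lambda>i. e i = d (q i))"
  by (rule Aut_eqI)
    (use assms permutes_compose[OF assms(2,1)] permutes_lessThan[OF assms(2)] in
      \<open>auto simp: Aut_mult_apply signed_perm_gen signed_perm_letter\<close>)

section \<open>Nielsen's theorem for the special automorphism group\<close>

context
  fixes n :: nat and H
  assumes H: "subgroup H (Aut n)"
    and transvections: "\<And>b i j. i < n \<Longrightarrow> j < n \<Longrightarrow> i \<noteq> j \<Longrightarrow> transvection n b i j \<in> H"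
begin

text \<open>This lifts the factorisation of the quarter turn x_i -> x_j, x_j -> x_i^-1 into three
  elementary matrices. The factor applied first is of the left kind, so that x_i passes through x_j
  x_i to x_j x_i^-1 x_i = x_j without commuting anything.\<close>

lemma signed_transpose_in_subgroup:
  assumes "i < n" "j < n" "i \<noteq> j"
  shows "signed_perm n (Transposition.transpose i j) (\<lambda>l. l \<noteq> j) \<in> H"
proof -
  let ?w = "transvection n True i j \<otimes>\<^bsub>Aut n\<^esub> inv\<^bsub>Aut n\<^esub> transvection n True j i
    \<otimes>\<^bsub>Aut n\<^esub> transvection n False i j"
  have p: "Transposition.transpose i j permutes {..<n}"
    using assms by (simp add: permutes_swap_id)
  have "?w = signed_perm n (Transposition.transpose i j) (\<lambda>l. l \<noteq> j)"
  proof (rule Aut_eqI)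
    fix l assume l: "l < n"
    have letter: "[(m, True)] = gen m" "[(m, False)] = inv\<^bsub>Fn n\<^esub> gen m" if "m < n" for m
      using that by (auto simp: gen_def inv_letter_word)
    show "?w (gen l) = signed_perm n (Transposition.transpose i j) (\<lambda>l. l \<noteq> j) (gen l)"
      using assms l p
      by (auto simp: Aut_mult_apply Aut_apply_mult Aut_apply_inv transvection_gen
          transvection_inv_gen signed_perm_gen letter Fn.inv_mult_group Transposition.transpose_def
          Fn.m_assoc)
       (simp_all add: Fn.m_assoc[symmetric])
  qed (use assms p in auto)
  moreover have "?w \<in> H"
    using assms transvections subgroup.m_closed[OF H] subgroup.m_inv_closed[OF H] by auto
  ultimately show ?thesis by simp
qed

text \<open>The square of a quarter turn inverts exactly x_i and x_j, so minus signs can be removed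
  in pairs.\<close>

lemma even_signs_in_subgroup:
  assumes "even (card {i. i < n \<and> \<not> e i})"
  shows "signed_perm n id e \<in> H"
  using assms
proof (induction "card {i. i < n \<and> \<not> e i}" arbitrary: e rule: less_induct)
  case less
  let ?N = "\<lambda>e. {i. i < n \<and> \<not> e i}"
  show ?case
  proof (cases "?N e = {}")
    case True
    have "signed_perm n id e = \<one>\<^bsub>Aut n\<^esub>"
      by (rule Aut_eqI) (use True in \<open>auto simp: signed_perm_letter permutes_id gen_def\<close>)
    then show ?thesis using subgroup.one_closed[OF H] by simp
  next
    case False
    then obtain i where i: "i < n" "\<not> e i" by blast
    have "?N e - {i} \<noteq> {}"
    proof
      assume "?N e - {i} = {}"
      then have "?N e = {i}" using i by blast
      then show False using less.prems by simp
    qed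
    then obtain j where j: "j < n" "\<not> e j" "j \<noteq> i" by blast
    let ?e = "e(i := True, j := True)"
    have N: "?N ?e = ?N e - {i, j}" by auto
    have "card (?N ?e) = card (?N e) - 2"
      unfolding N using i j by (subst card_Diff_subset) auto
    moreover have "card {i, j} \<le> card (?N e)" using i j by (intro card_mono) auto
    ultimately have "card (?N ?e) < card (?N e)" "even (card (?N ?e))"
      using less.prems j(3) by auto
    then have "signed_perm n id ?e \<in> H" by (rule less.hyps)
    moreover let ?t = "signed_perm n (Transposition.transpose i j) (\<lambda>l. l \<noteq> j)"
    have "?t \<in> H" using signed_transpose_in_subgroup i j by blast
    moreover have "?t \<otimes>\<^bsub>Aut n\<^esub> ?t \<otimes>\<^bsub>Aut n\<^esub> signed_perm n id ?e = signed_perm n id e"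
    proof -
      have p: "Transposition.transpose i j permutes {..<n}"
        using i j by (simp add: permutes_swap_id)
      define d where "d l \<longleftrightarrow> (l \<noteq> j) = (Transposition.transpose i j l \<noteq> j)" for l
      have "?t \<otimes>\<^bsub>Aut n\<^esub> ?t = signed_perm n id d"
        unfolding signed_perm_mult[OF p p] d_def by simp
      moreover have "(\<lambda>l. ?e l = d (id l)) = e"
        using i j by (auto simp: Transposition.transpose_def fun_eq_iff d_def)
      ultimately show ?thesis
        using signed_perm_mult[OF permutes_id permutes_id, of n d ?e] by (simp only: comp_id)
    qed
    ultimately show ?thesis using subgroup.m_closed[OF H] by metis
  qed
qed

text \<open>Quarter turns realise \<open>p\<close> with some signs \<open>d\<close>. The remaining
  correction is a diagonal matrix of determinant 1, so it inverts an even number of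
  generators.\<close>

lemma signed_perm_in_subgroup:
  assumes p: "p permutes {..<n}" and det: "det (abel_mat n (signed_perm n p e)) = 1"
  shows "signed_perm n p e \<in> H"
proof -
  let ?K = "H \<inter> carrier (Aut_plus n)"
  have K: "subgroup ?K (Aut n)"
    by (rule Aut.subgroups_Inter_pair[OF H subgroup_Aut_plus])
  have "\<exists>d. signed_perm n p d \<in> H \<inter> carrier (Aut_plus n)"
    using p finite_lessThan
  proof (induction rule: permutes_induct)
    case id
    have "signed_perm n id (\<lambda>_. True) = \<one>\<^bsub>Aut n\<^esub>"
      by (rule Aut_eqI) (auto simp: signed_perm_letter permutes_id gen_def)
    then show ?case using subgroup.one_closed[OF K] by metis
  next
    case (swap a b p)
    then obtain d where d: "signed_perm n p d \<in> ?K" by blast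
    let ?t = "Transposition.transpose a b"
    have t: "?t permutes {..<n}" using swap by (simp add: permutes_swap_id)
    have "det (abel_mat n (signed_perm n ?t (\<lambda>l. l \<noteq> b))) = 1"
    proof -
      have "(\<Prod>i<n. if i \<noteq> b then 1 else -1 :: int) = -1"
        using swap by (subst prod.remove[of _ b]) auto
      then show ?thesis using swap det_signed_perm[OF t] by (simp add: sign_swap_id)
    qed
    then have ts: "signed_perm n ?t (\<lambda>l. l \<noteq> b) \<in> ?K"
      using swap signed_transpose_in_subgroup t by (auto simp: Aut_plus_iff)
    show ?case
      using subgroup.m_closed[OF K ts d] unfolding signed_perm_mult[OF t \<open>p permutes {..<n}\<close>] by blast
  qed
  then obtain d where d: "signed_perm n p d \<in> ?K" by blast
  define e' where "e' i = (e i = d i)" for i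
  have eq: "signed_perm n p e = signed_perm n p d \<otimes>\<^bsub>Aut n\<^esub> signed_perm n id e'"
  proof -
    have "(\<lambda>i. e' i = d (id i)) = e" by (auto simp: e'_def fun_eq_iff)
    then show ?thesis using signed_perm_mult[OF p permutes_id, of d e'] by (simp only: comp_id)
  qed
  have "det (abel_mat n (signed_perm n id e')) = 1"
    using det d det_mult[OF abel_mat_carrier abel_mat_carrier, of n "signed_perm n p d" "signed_perm n id e'"]
    by (simp add: eq abel_mat_mult p permutes_id Aut_plus_iff)
  then have "(\<Prod>i<n. if e' i then 1 else -1 :: int) = 1"
    by (simp add: det_signed_perm permutes_id)
  moreover have "(\<Prod>i<n. if e' i then 1 else -1 :: int) = (-1) ^ card {i. i < n \<and> \<not> e' i}"
    by (simp add: prod.If_cases) (simp add: Collect_conj_eq lessThan_def Compl_eq)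
  ultimately have "even (card {i. i < n \<and> \<not> e' i})"
    by (metis neg_one_odd_power one_neq_neg_one)
  then have "signed_perm n id e' \<in> H" by (rule even_signs_in_subgroup)
  then show ?thesis unfolding eq using d subgroup.m_closed[OF H] by blast
qed

theorem Aut_plus_subset_transvection_subgroup: "carrier (Aut_plus n) \<subseteq> H"
proof
  fix \<phi> assume \<phi>: "\<phi> \<in> carrier (Aut_plus n)"
  \<comment> \<open>Moving within the intersection keeps the determinant equal to 1, which is what
    admits the signed permutation at the end of the reduction to \<open>H\<close>.\<close>
  let ?K = "H \<inter> carrier (Aut_plus n)"
  have K: "subgroup ?K (Aut n)"
    by (rule Aut.subgroups_Inter_pair[OF H subgroup_Aut_plus])
  have \<phi>A: "\<phi> \<in> carrier (Aut n)" using \<phi> by (rule Aut_plus_carrierD)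
  obtain \<gamma> where \<gamma>: "\<gamma> \<in> ?K" "nielsen_minimal n (\<phi> \<otimes>\<^bsub>Aut n\<^esub> \<gamma>)"
    using nielsen_minimal_exists[OF K _ \<phi>A] transvections by (metis IntI transvection_in_Aut_plus)
  then obtain p e where p: "p permutes {..<n}"
    and eq: "inv\<^bsub>Aut n\<^esub> (\<phi> \<otimes>\<^bsub>Aut n\<^esub> \<gamma>) = signed_perm n p e"
    using nielsen_minimal_inverse_signed_perm by metis
  have \<gamma>A: "\<gamma> \<in> carrier (Aut n)" using \<gamma> Aut_plus_carrierD by blast
  have "signed_perm n p e \<in> carrier (Aut_plus n)"
    unfolding eq[symmetric] using \<phi> \<gamma>(1) subgroup_Aut_plus
    by (intro subgroup.m_inv_closed[OF subgroup_Aut_plus] subgroup.m_closed[OF subgroup_Aut_plus]) auto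
  then have "signed_perm n p e \<in> H"
    using signed_perm_in_subgroup[OF p] by (simp add: Aut_plus_iff)
  then have "inv\<^bsub>Aut n\<^esub> (inv\<^bsub>Aut n\<^esub> (\<phi> \<otimes>\<^bsub>Aut n\<^esub> \<gamma>)) \<otimes>\<^bsub>Aut n\<^esub> inv\<^bsub>Aut n\<^esub> \<gamma> \<in> H"
    unfolding eq using \<gamma>(1) subgroup.m_inv_closed[OF H] subgroup.m_closed[OF H] by blast
  then show "\<phi> \<in> H" using \<phi>A \<gamma>A by (simp add: Aut.m_assoc)
qed

end

section \<open>Surjectivity onto the special linear group\<close>

lemma exponent_sum_inv_gen: "j < n \<Longrightarrow> exponent_sum i (inv\<^bsub>Fn n\<^esub> gen j) = - of_bool (i = j)"
  by (simp add: gen_def inv_letter_word)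

lemma mult_abel_mat_transvection:
  fixes c :: int
  assumes A: "A \<in> carrier_mat n n" and "i < n" "j < n" "i \<noteq> j" and c: "c = 1 \<or> c = -1"
  obtains \<gamma> where "\<gamma> \<in> carrier (Aut_plus n)"
    "\<And>r x. r < n \<Longrightarrow> x < n \<Longrightarrow> (A * abel_mat n \<gamma>) $$ (r, x) =
      (if x = i then A $$ (r, i) + c * A $$ (r, j) else A $$ (r, x))"
proof -
  let ?\<gamma> = "if c = 1 then transvection n True i j else inv\<^bsub>Aut n\<^esub> transvection n True i j"
  have gen: "abel_mat n ?\<gamma> $$ (y, x) = of_bool (y = x) + (if x = i then c * of_bool (y = j) else 0)"
    if "x < n" "y < n" for x y
    using assms that by (auto simp: abel_mat_index transvection_gen transvection_inv_gen
        exponent_sum_inv_gen)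
  show ?thesis
  proof
    show "?\<gamma> \<in> carrier (Aut_plus n)"
      using assms subgroup.m_inv_closed[OF subgroup_Aut_plus] by auto
    fix r x assume rx: "r < n" "x < n"
    have "(A * abel_mat n ?\<gamma>) $$ (r, x) = (\<Sum>y<n. A $$ (r, y) * abel_mat n ?\<gamma> $$ (y, x))"
      using A rx by (simp add: scalar_prod_def atLeast0LessThan)
    also have "\<dots> = (\<Sum>y<n. (if y = x then A $$ (r, x) else 0) +
        (if y = j then (if x = i then c * A $$ (r, j) else 0) else 0))"
      by (rule sum.cong) (use rx gen[OF rx(2)] in \<open>auto simp: algebra_simps\<close>)
    also have "\<dots> = (if x = i then A $$ (r, i) + c * A $$ (r, j) else A $$ (r, x))"
      using assms rx by (simp add: sum.distrib)
    finally show "(A * abel_mat n ?\<gamma>) $$ (r, x) =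
      (if x = i then A $$ (r, i) + c * A $$ (r, j) else A $$ (r, x))" .
  qed
qed

lemma abs_add_less_cases:
  fixes a b :: int
  assumes "b \<noteq> 0" "\<bar>b\<bar> \<le> \<bar>a\<bar>"
  obtains c where "c = 1 \<or> c = -1" "\<bar>a + c * b\<bar> < \<bar>a\<bar>"
proof (cases "(a > 0) = (b > 0)")
  case True
  then show ?thesis using assms that[of "-1"] by auto
next
  case False
  then show ?thesis using assms that[of 1] by auto
qed

lemma abel_mat_mult_plus:
  assumes "\<phi> \<in> carrier (Aut_plus n)" "\<psi> \<in> carrier (Aut_plus n)"
  shows "\<phi> \<otimes>\<^bsub>Aut n\<^esub> \<psi> \<in> carrier (Aut_plus n)"
    and "A \<in> carrier_mat n n \<Longrightarrow>
      A * abel_mat n (\<phi> \<otimes>\<^bsub>Aut n\<^esub> \<psi>) = A * abel_mat n \<phi> * abel_mat n \<psi>"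
  using assms subgroup.m_closed[OF subgroup_Aut_plus]
  by (auto simp: abel_mat_mult Aut_plus_carrierD assoc_mult_mat[OF _ abel_mat_carrier abel_mat_carrier])

lemma SL_mult_abel_mat:
  "A \<in> carrier (SL n) \<Longrightarrow> \<gamma> \<in> carrier (Aut_plus n) \<Longrightarrow> A * abel_mat n \<gamma> \<in> carrier (SL n)"
  by (auto simp: SL_def Aut_plus_iff det_mult[of _ n])

text \<open>One step of column reduction: once the first \<open>r\<close> rows are signed unit vectors, supported in the
  columns \<open>m ` {..<r}\<close>, minimise the next row over the column operations that add a column outside
  this support to another one. The equation \<open>A * B = 1\<close> shows that the row does not vanish outside
  the support.\<close>

lemma reduce_row:
  fixes A :: "int mat"
  assumes A: "A \<in> carrier (SL n)" and r: "r < n"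
    and m: "inj_on m {..<r}" "m ` {..<r} \<subseteq> {..<n}"
    and s: "\<And>i. i < r \<Longrightarrow> s i = 1 \<or> s i = -1"
    and rows: "\<And>i j. i < r \<Longrightarrow> j < n \<Longrightarrow> A $$ (i, j) = (if j = m i then s i else 0)"
  obtains \<gamma> k c where "\<gamma> \<in> carrier (Aut_plus n)" "k < n" "k \<notin> m ` {..<r}" "c = 1 \<or> c = -1"
    "\<And>i j. i < r \<Longrightarrow> j < n \<Longrightarrow> (A * abel_mat n \<gamma>) $$ (i, j) = A $$ (i, j)"
    "\<And>j. j < n \<Longrightarrow> (A * abel_mat n \<gamma>) $$ (r, j) = (if j = k then c else 0)"
proof -
  define P where "P \<gamma> \<longleftrightarrow> \<gamma> \<in> carrier (Aut_plus n) \<and>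
    (\<forall>i<r. \<forall>j<n. (A * abel_mat n \<gamma>) $$ (i, j) = A $$ (i, j))" for \<gamma>
  define f where "f \<gamma> = (\<Sum>j<n. nat \<bar>(A * abel_mat n \<gamma>) $$ (r, j)\<bar>)" for \<gamma>
  have Ac: "A \<in> carrier_mat n n" using A by (simp add: SL_def)
  have "P \<one>\<^bsub>Aut n\<^esub>"
    using Ac subgroup.one_closed[OF subgroup_Aut_plus] by (simp add: P_def abel_mat_one)
  then obtain \<gamma> where P: "P \<gamma>" and min: "\<And>\<gamma>'. P \<gamma>' \<Longrightarrow> f \<gamma> \<le> f \<gamma>'"
    using ex_has_least_nat[of P _ f] by blast
  define A' where "A' = A * abel_mat n \<gamma>"
  have \<gamma>: "\<gamma> \<in> carrier (Aut_plus n)" using P by (simp add: P_def)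
  have A': "A' \<in> carrier (SL n)" unfolding A'_def by (rule SL_mult_abel_mat[OF A \<gamma>])
  then have A'c: "A' \<in> carrier_mat n n" by (simp add: SL_def)
  have rows': "A' $$ (i, j) = (if j = m i then s i else 0)" if "i < r" "j < n" for i j
    using P that rows unfolding P_def A'_def by simp
  \<comment> \<open>Otherwise adding or subtracting column j would lower entry i of row r. Column j
    lies outside the support and so vanishes in the earlier rows, which are therefore preserved,
    against the choice of \<gamma>.\<close>
  have small: "\<bar>A' $$ (r, i)\<bar> < \<bar>A' $$ (r, j)\<bar>"
    if ij: "i < n" "j < n" "i \<noteq> j" "j \<notin> m ` {..<r}" "A' $$ (r, j) \<noteq> 0" for i j
  proof (rule ccontr)
    assume "\<not> ?thesis"
    then obtain c where c: "c = 1 \<or> c = -1" "\<bar>A' $$ (r, i) + c * A' $$ (r, j)\<bar> < \<bar>A' $$ (r, i)\<bar>"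
      using abs_add_less_cases[OF ij(5), of "A' $$ (r, i)"] by (auto simp: not_less)
    obtain \<tau> where \<tau>: "\<tau> \<in> carrier (Aut_plus n)" and
      col: "\<And>r x. r < n \<Longrightarrow> x < n \<Longrightarrow> (A' * abel_mat n \<tau>) $$ (r, x) =
        (if x = i then A' $$ (r, i) + c * A' $$ (r, j) else A' $$ (r, x))"
      using mult_abel_mat_transvection[OF A'c ij(1-3) c(1)] by blast
    have eq: "A * abel_mat n (\<gamma> \<otimes>\<^bsub>Aut n\<^esub> \<tau>) = A' * abel_mat n \<tau>"
      unfolding A'_def by (rule abel_mat_mult_plus(2)[OF \<gamma> \<tau> Ac])
    have "A' $$ (i', j) = 0" if "i' < r" for i'
      using rows'[OF that ij(2)] ij(4) that by auto
    then have "P (\<gamma> \<otimes>\<^bsub>Aut n\<^esub> \<tau>)"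
      using P abel_mat_mult_plus(1)[OF \<gamma> \<tau>] r by (auto simp: P_def eq col A'_def[symmetric])
    moreover have "f (\<gamma> \<otimes>\<^bsub>Aut n\<^esub> \<tau>) < f \<gamma>"
      unfolding f_def eq A'_def[symmetric]
      by (rule sum_strict_mono_ex1) (use col[OF r] c ij(1) in auto)
    ultimately show False using min by (simp add: not_le[symmetric])
  qed
  obtain B where B: "B \<in> carrier (SL n)" "A' * B = 1\<^sub>m n"
    using group.r_inv[OF group_SL A'] group.inv_closed[OF group_SL A'] by (auto simp: SL_def)
  then have Bc: "B \<in> carrier_mat n n" by (simp add: SL_def)
  have prod: "(\<Sum>j<n. A' $$ (i, j) * B $$ (j, r)) = of_bool (i = r)" if "i < n" for i
  proof -
    have "(A' * B) $$ (i, r) = (\<Sum>j<n. A' $$ (i, j) * B $$ (j, r))"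
      using A'c Bc that r by (simp add: scalar_prod_def atLeast0LessThan)
    then show ?thesis using that r unfolding B(2) by (cases "i = r") simp_all
  qed
  have B0: "B $$ (m i, r) = 0" if i: "i < r" for i
  proof -
    have "(\<Sum>j<n. A' $$ (i, j) * B $$ (j, r)) = (\<Sum>j<n. if j = m i then s i * B $$ (m i, r) else 0)"
      by (rule sum.cong) (use rows'[OF i] in auto)
    also have "\<dots> = s i * B $$ (m i, r)" using m(2) i by auto
    finally show ?thesis using prod[of i] i r s[OF i] by auto
  qed
  have "\<exists>k<n. A' $$ (r, k) * B $$ (k, r) \<noteq> 0"
  proof (rule ccontr)
    assume "\<not> ?thesis"
    then have "(\<Sum>j<n. A' $$ (r, j) * B $$ (j, r)) = 0" by (intro sum.neutral) auto
    then show False using prod[OF r] by simp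
  qed
  then obtain k where k: "k < n" "A' $$ (r, k) \<noteq> 0" "B $$ (k, r) \<noteq> 0" by auto
  have kM: "k \<notin> m ` {..<r}" using B0 k(3) by auto
  \<comment> \<open>Two nonzero entries outside the support would each be strictly smaller than the
    other, and inside the support column r of \<open>B\<close> vanishes. So one term of the sum
    remains, and it equals 1.\<close>
  have "A' $$ (r, j) * B $$ (j, r) = 0" if "j < n" "j \<noteq> k" for j
  proof (cases "j \<in> m ` {..<r}")
    case True
    then show ?thesis using B0 by auto
  next
    case False
    then have "A' $$ (r, j) = 0"
      using small[OF that(1) k(1) that(2) kM k(2)] small[OF k(1) that(1) that(2)[symmetric] False]
      by (meson less_asym)
    then show ?thesis by simp
  qed
  then have "(\<Sum>j<n. A' $$ (r, j) * B $$ (j, r)) = (\<Sum>j<n. if j = k then A' $$ (r, k) * B $$ (k, r) else 0)"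
    by (intro sum.cong) auto
  then have "A' $$ (r, k) * B $$ (k, r) = 1" using prod[OF r] k(1) by simp
  then have c: "A' $$ (r, k) = 1 \<or> A' $$ (r, k) = -1"
    using zmult_eq_1_iff by blast
  \<comment> \<open>Here \<open>small\<close> is applied also to columns inside the support: every
    other entry of the row is smaller in absolute value than a unit.\<close>
  have zero: "A' $$ (r, j) = 0" if "j < n" "j \<noteq> k" for j
    using small[OF that(1) k(1) that(2) kM k(2)] c by auto
  show ?thesis
  proof
    show "(A * abel_mat n \<gamma>) $$ (i, j) = A $$ (i, j)" if "i < r" "j < n" for i j
      using P that by (simp add: P_def)
    show "(A * abel_mat n \<gamma>) $$ (r, j) = (if j = k then A' $$ (r, k) else 0)" if "j < n" for j
      using zero[OF that] unfolding A'_def by simp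
  qed (use \<gamma> k kM c in auto)
qed

lemma reduce_rows:
  fixes A :: "int mat"
  assumes A: "A \<in> carrier (SL n)" and "r \<le> n"
  shows "\<exists>\<gamma> m s. \<gamma> \<in> carrier (Aut_plus n) \<and> inj_on m {..<r} \<and> m ` {..<r} \<subseteq> {..<n} \<and>
    (\<forall>i<r. (s i = 1 \<or> s i = -1) \<and>
      (\<forall>j<n. (A * abel_mat n \<gamma>) $$ (i, j) = (if j = m i then s i else 0)))"
  using assms(2)
proof (induction r)
  case 0
  have "\<one>\<^bsub>Aut n\<^esub> \<in> carrier (Aut_plus n)" by (rule subgroup.one_closed[OF subgroup_Aut_plus])
  then show ?case by auto
next
  case (Suc r)
  then obtain \<gamma> m s where \<gamma>: "\<gamma> \<in> carrier (Aut_plus n)" and m: "inj_on m {..<r}" "m ` {..<r} \<subseteq> {..<n}"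
    and s: "\<And>i. i < r \<Longrightarrow> s i = 1 \<or> s i = -1"
    and rows: "\<And>i j. i < r \<Longrightarrow> j < n \<Longrightarrow> (A * abel_mat n \<gamma>) $$ (i, j) = (if j = m i then s i else 0)"
    by (metis Suc_leD)
  have r: "r < n" using Suc.prems by simp
  obtain \<gamma>' k c where *: "\<gamma>' \<in> carrier (Aut_plus n)" "k < n" "k \<notin> m ` {..<r}" "c = 1 \<or> c = -1"
    "\<And>i j. i < r \<Longrightarrow> j < n \<Longrightarrow> (A * abel_mat n \<gamma> * abel_mat n \<gamma>') $$ (i, j) = (A * abel_mat n \<gamma>) $$ (i, j)"
    "\<And>j. j < n \<Longrightarrow> (A * abel_mat n \<gamma> * abel_mat n \<gamma>') $$ (r, j) = (if j = k then c else 0)"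
    by (rule reduce_row[OF SL_mult_abel_mat[OF A \<gamma>] r m s rows]) blast+
  let ?m = "m(r := k)" and ?s = "s(r := c)"
  have "A \<in> carrier_mat n n" using A by (simp add: SL_def)
  then have eq: "A * abel_mat n (\<gamma> \<otimes>\<^bsub>Aut n\<^esub> \<gamma>') = A * abel_mat n \<gamma> * abel_mat n \<gamma>'"
    by (rule abel_mat_mult_plus(2)[OF \<gamma> *(1)])
  have "inj_on ?m {..<Suc r}" "?m ` {..<Suc r} \<subseteq> {..<n}"
    using m *(2,3) by (auto simp: lessThan_Suc inj_on_def)
  moreover have "(?s i = 1 \<or> ?s i = -1) \<and> (\<forall>j<n. (A * abel_mat n (\<gamma> \<otimes>\<^bsub>Aut n\<^esub> \<gamma>')) $$ (i, j) =
      (if j = ?m i then ?s i else 0))" if "i < Suc r" for i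
    using that s *(4-6) rows unfolding eq by (cases "i = r") auto
  ultimately show ?case using abel_mat_mult_plus(1)[OF \<gamma> *(1)] by blast
qed

theorem abel_mat_surj: "abel_mat n ` carrier (Aut_plus n) = carrier (SL n)"
proof
  show "abel_mat n ` carrier (Aut_plus n) \<subseteq> carrier (SL n)" by (auto simp: Aut_plus_def)
  show "carrier (SL n) \<subseteq> abel_mat n ` carrier (Aut_plus n)"
  proof
    fix A assume A: "A \<in> carrier (SL n)"
    obtain \<gamma> m s where \<gamma>: "\<gamma> \<in> carrier (Aut_plus n)" and m: "inj_on m {..<n}" "m ` {..<n} \<subseteq> {..<n}"
      and s: "\<And>i. i < n \<Longrightarrow> s i = 1 \<or> s i = -1"
      and rows: "\<And>i j. i < n \<Longrightarrow> j < n \<Longrightarrow> (A * abel_mat n \<gamma>) $$ (i, j) = (if j = m i then s i else 0)"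
      using reduce_rows[OF A le_refl] by metis
    have Ac: "A \<in> carrier_mat n n" using A by (simp add: SL_def)
    define p where "p i = (if i < n then m i else i)" for i
    have "bij_betw p {..<n} {..<n}"
    proof -
      have "inj_on p {..<n}" "p ` {..<n} \<subseteq> {..<n}" using m by (auto simp: p_def inj_on_def)
      then show ?thesis by (simp add: bij_betw_def endo_inj_surj)
    qed
    then have p: "p permutes {..<n}" by (rule bij_imp_permutes) (simp add: p_def)
    let ?q = "inv_into UNIV p"
    have q: "?q permutes {..<n}" using p by (rule permutes_inv)
    \<comment> \<open>Row i has its entry in column m i. Thus x_j goes to the generator whose row is
      supported in column j, with the sign of that row.\<close>
    let ?\<sigma> = "signed_perm n ?q (\<lambda>j. s (?q j) = 1)"
    have eq: "A * abel_mat n \<gamma> = abel_mat n ?\<sigma>"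
    proof (rule eq_matI)
      fix i j assume "i < dim_row (abel_mat n ?\<sigma>)" "j < dim_col (abel_mat n ?\<sigma>)"
      then have ij: "i < n" "j < n" by auto
      have "i = ?q j \<longleftrightarrow> j = m i" using permutes_inv_eq[OF p, of j i] ij by (auto simp: p_def)
      then show "(A * abel_mat n \<gamma>) $$ (i, j) = abel_mat n ?\<sigma> $$ (i, j)"
        unfolding rows[OF ij] using ij q s by (auto simp: abel_mat_index signed_perm_gen)
    qed (use Ac in auto)
    have "det (A * abel_mat n \<gamma>) = 1" using SL_mult_abel_mat[OF A \<gamma>] by (simp add: SL_def)
    then have \<sigma>: "?\<sigma> \<in> carrier (Aut_plus n)" using q by (simp add: Aut_plus_iff eq)
    have \<gamma>i: "inv\<^bsub>Aut n\<^esub> \<gamma> \<in> carrier (Aut_plus n)"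
      by (rule subgroup.m_inv_closed[OF subgroup_Aut_plus \<gamma>])
    have "abel_mat n (?\<sigma> \<otimes>\<^bsub>Aut n\<^esub> inv\<^bsub>Aut n\<^esub> \<gamma>) = A * abel_mat n \<gamma> * abel_mat n (inv\<^bsub>Aut n\<^esub> \<gamma>)"
      using \<sigma> \<gamma>i by (simp add: abel_mat_mult Aut_plus_carrierD eq)
    also have "\<dots> = A * abel_mat n (\<gamma> \<otimes>\<^bsub>Aut n\<^esub> inv\<^bsub>Aut n\<^esub> \<gamma>)"
      using abel_mat_mult_plus(2)[OF \<gamma> \<gamma>i Ac] by simp
    also have "\<dots> = A" using Ac Aut_plus_carrierD[OF \<gamma>] by (simp add: abel_mat_one)
    finally show "A \<in> abel_mat n ` carrier (Aut_plus n)"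
      using abel_mat_mult_plus(1)[OF \<sigma> \<gamma>i] by (metis image_eqI)
  qed
qed

section \<open>Block rotations\<close>

text \<open>\<open>block_rotation k a b\<close> cyclically permutes each of the consecutive blocks
  \<open>{a..<a + k}, {a + k..<a + 2 * k}, \<dots>\<close> that make up \<open>{a..<b}\<close>, where \<open>k\<close> divides \<open>b - a\<close>.\<close>

definition block_rotation :: "nat \<Rightarrow> nat \<Rightarrow> nat \<Rightarrow> nat \<Rightarrow> nat" where
  "block_rotation k a b i =
     (if a \<le> i \<and> i < b then a + (i - a) div k * k + Suc ((i - a) mod k) mod k else i)"

lemma block_rotation_funpow:
  assumes i: "a \<le> i" "i < a + q * k"
  shows "(block_rotation k a (a + q * k) ^^ j) i = a + (i - a) div k * k + ((i - a) mod k + j) mod k"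
proof (induction j)
  case 0
  then show ?case using i by (simp add: mult.commute)
next
  case (Suc j)
  let ?d = "(i - a) div k" and ?e = "((i - a) mod k + j) mod k"
  have k: "k > 0" using i by (cases k) auto
  then have e: "?e < k" by simp
  have "?d < q" using i k by (simp add: div_less_iff_less_mult less_diff_conv2)
  then have "Suc ?d * k \<le> q * k" by (intro mult_right_mono) auto
  then have less: "?d * k + ?e < q * k" using e by simp
  have "block_rotation k a (a + q * k) (a + ?d * k + ?e) = a + ?d * k + Suc ?e mod k"
    using less e by (simp add: block_rotation_def)
  then show ?case using Suc by (simp add: mod_Suc_eq)
qed

lemma block_rotation_funpow_period: "(block_rotation k a (a + q * k) ^^ k) = id"
proof
  fix i
  show "(block_rotation k a (a + q * k) ^^ k) i = id i"
  proof (cases "a \<le> i \<and> i < a + q * k")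
    case True
    then show ?thesis using block_rotation_funpow[of a i q k k] by simp
  next
    case False
    have "(block_rotation k a (a + q * k) ^^ j) i = i" for j
      using False by (induction j) (auto simp: block_rotation_def)
    then show ?thesis by simp
  qed
qed

lemma block_rotation_Suc:
  assumes "a \<le> i" "i < b" "Suc ((i - a) mod k) \<noteq> k"
  shows "block_rotation k a b i = Suc i"
proof -
  have "k > 0 \<Longrightarrow> Suc ((i - a) mod k) < k" using assms(3) by (meson Suc_lessI mod_less_divisor)
  then have "Suc ((i - a) mod k) mod k = Suc ((i - a) mod k)" by (cases "k = 0") auto
  then show ?thesis using assms(1,2) by (simp add: block_rotation_def)
qed

lemma block_rotation_outside: "i < a \<or> b \<le> i \<Longrightarrow> block_rotation k a b i = i"
  by (auto simp: block_rotation_def)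

lemma funpow_period_bij:
  assumes "f ^^ k = id" "k > 0"
  shows "bij f"
proof -
  obtain l where l: "k = Suc l" using assms(2) gr0_implies_Suc by blast
  have "f \<circ> (f ^^ l) = id" "(f ^^ l) \<circ> f = id"
    using assms(1) unfolding l by (simp_all add: funpow_Suc_right[symmetric] del: funpow.simps(2))
      (simp add: funpow.simps(2))
  then show ?thesis using o_bij by blast
qed

lemma block_rotation_permutes:
  assumes "k > 0" "a + q * k \<le> n"
  shows "block_rotation k a (a + q * k) permutes {..<n}"
proof -
  have "bij (block_rotation k a (a + q * k))"
    using block_rotation_funpow_period assms(1) by (rule funpow_period_bij)
  then show ?thesis
    using assms(2) by (auto simp: permutes_def bij_iff block_rotation_outside)
qed

section \<open>Elements of order \<open>k\<close>\<close>

text \<open>An odd \<open>p\<close> is corrected to determinant 1 by inverting the generator at a fixed point \<open>c\<close>;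
  this does not change the order, since the order of an odd permutation is even.\<close>

definition special_perm :: "nat \<Rightarrow> (nat \<Rightarrow> nat) \<Rightarrow> nat \<Rightarrow> (nat \<times> bool) list \<Rightarrow> (nat \<times> bool) list" where
  "special_perm n p c = signed_perm n p (\<lambda>i. i = c \<longrightarrow> evenperm p)"

lemma special_perm_in_Aut_plus:
  assumes "p permutes {..<n}" "c < n"
  shows "special_perm n p c \<in> carrier (Aut_plus n)"
proof -
  have "(\<Prod>i<n. if i = c \<longrightarrow> evenperm p then 1 else -1 :: int) = sign p"
    using assms(2) by (subst prod.remove[of _ c]) (auto simp: sign_def)
  then show ?thesis
    using assms det_signed_perm[of p n] by (simp add: special_perm_def Aut_plus_iff)
qed

lemma evenperm_funpow:
  assumes "permutation p"
  shows "permutation (p ^^ j) \<and> (evenperm (p ^^ j) \<longleftrightarrow> evenperm p \<or> even j)"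
proof (induction j)
  case (Suc j)
  then show ?case
    unfolding funpow.simps(2)
    using assms permutation_compose[of p "p ^^ j"] evenperm_comp[of p "p ^^ j"]
    by (auto simp del: comp_apply)
qed (simp add: id_def[symmetric])

lemma special_perm_pow_gen:
  assumes p: "p permutes {..<n}" "p c = c" and i: "i < n" "i \<noteq> c"
  shows "(special_perm n p c [^]\<^bsub>Aut n\<^esub> (j::nat)) (gen i) = gen ((p ^^ j) i)"
  using i
proof (induction j arbitrary: i)
  case (Suc j)
  have x: "special_perm n p c \<in> carrier (Aut n)" using p(1) by (simp add: special_perm_def)
  have "p i \<noteq> c" using p Suc.prems(2) permutes_inj[OF p(1)] by (metis injD)
  moreover have "special_perm n p c (gen i) = gen (p i)"
    using p(1) Suc.prems by (simp add: special_perm_def signed_perm_letter gen_def)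
  ultimately show ?case
    using Suc x permutes_lessThan[OF p(1)]
    by (simp add: Aut_mult_apply funpow_swap1)
qed simp

lemma special_perm_pow_fixed:
  assumes p: "p permutes {..<n}" "p c = c" and c: "c < n"
  shows "(special_perm n p c [^]\<^bsub>Aut n\<^esub> (j::nat)) [(c, d)] = [(c, d = (evenperm p \<or> even j))]"
proof (induction j arbitrary: d)
  case (Suc j)
  have x: "special_perm n p c \<in> carrier (Aut n)" using p(1) by (simp add: special_perm_def)
  have "special_perm n p c [(c, d)] = [(c, d = evenperm p)]"
    using p c by (simp add: special_perm_def signed_perm_letter)
  then show ?case using Suc x c by (auto simp: Aut_mult_apply)
qed (simp add: c)

lemma special_perm_pow_period:
  assumes p: "p permutes {..<n}" "p c = c" and c: "c < n" and k: "p ^^ k = id"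
  shows "special_perm n p c [^]\<^bsub>Aut n\<^esub> k = \<one>\<^bsub>Aut n\<^esub>"
proof (rule Aut_eqI)
  have "permutation p" using p(1) permutation_permutes finite_lessThan by blast
  then have "evenperm p \<or> even k" using evenperm_funpow[of p k] k by simp
  then show "(special_perm n p c [^]\<^bsub>Aut n\<^esub> k) (gen i) = \<one>\<^bsub>Aut n\<^esub> (gen i)" if "i < n" for i
    using special_perm_pow_gen[OF p that, of k] special_perm_pow_fixed[OF p c, of k True] that k
    by (cases "i = c") (auto simp: gen_def)
qed (use p(1) in \<open>simp_all add: special_perm_def\<close>)

text \<open>The order is bounded above in \<open>Aut n\<close> and below in the image in
  \<open>SL n\<close>. This forces order exactly k (for positive k) in every group between the two,
  and the condition survives conjugation.\<close>

definition faithful_order :: "nat \<Rightarrow> nat \<Rightarrow> ((nat \<times> bool) list \<Rightarrow> (nat \<times> bool) list) \<Rightarrow> bool" where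
  "faithful_order n k \<phi> \<longleftrightarrow> \<phi> \<in> carrier (Aut_plus n) \<and> \<phi> [^]\<^bsub>Aut n\<^esub> k = \<one>\<^bsub>Aut n\<^esub> \<and>
     (\<forall>d. 0 < d \<longrightarrow> d < k \<longrightarrow> abel_mat n (\<phi> [^]\<^bsub>Aut n\<^esub> d) \<noteq> 1\<^sub>m n)"

text \<open>A point \<open>i\<close> that does not return before time \<open>k\<close> gives the
  smaller powers a zero diagonal entry at \<open>i\<close>. Its orbit avoids \<open>c\<close>, so
  the sign correction does not interfere.\<close>

lemma special_perm_faithful_order:
  assumes p: "p permutes {..<n}" "p c = c" and c: "c < n" and k: "p ^^ k = id"
    and i: "i < n" "i \<noteq> c" and moved: "\<And>d. 0 < d \<Longrightarrow> d < k \<Longrightarrow> (p ^^ d) i \<noteq> i"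
  shows "faithful_order n k (special_perm n p c)"
proof -
  have "abel_mat n (special_perm n p c [^]\<^bsub>Aut n\<^esub> d) \<noteq> 1\<^sub>m n" if "0 < d" "d < k" for d
  proof
    assume "abel_mat n (special_perm n p c [^]\<^bsub>Aut n\<^esub> d) = 1\<^sub>m n"
    then have "abel_mat n (special_perm n p c [^]\<^bsub>Aut n\<^esub> d) $$ (i, i) = 1" using i by simp
    then show False
      using special_perm_pow_gen[OF p i, of d] i moved[OF that] by (auto simp: abel_mat_index)
  qed
  then show ?thesis
    using special_perm_in_Aut_plus[OF p(1) c] special_perm_pow_period[OF p c k]
    by (simp add: faithful_order_def)
qed

lemma (in group) conj_nat_pow:
  assumes "t \<in> carrier G" "x \<in> carrier G"
  shows "(inv t \<otimes> x \<otimes> t) [^] (d::nat) = inv t \<otimes> x [^] d \<otimes> t"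
proof (induction d)
  case (Suc d)
  have "t \<otimes> (inv t \<otimes> y) = y" if "y \<in> carrier G" for y
    using assms that by (simp add: m_assoc[symmetric])
  then show ?case using Suc assms by (simp add: m_assoc)
qed (use assms in simp)

lemma faithful_order_conj:
  assumes "faithful_order n k \<phi>" "\<tau> \<in> carrier (Aut_plus n)"
  shows "faithful_order n k (inv\<^bsub>Aut n\<^esub> \<tau> \<otimes>\<^bsub>Aut n\<^esub> \<phi> \<otimes>\<^bsub>Aut n\<^esub> \<tau>)"
proof -
  have \<phi>: "\<phi> \<in> carrier (Aut_plus n)" "\<phi> \<in> carrier (Aut n)" and \<tau>: "\<tau> \<in> carrier (Aut n)"
    using assms by (auto simp: faithful_order_def Aut_plus_carrierD)
  have pow: "(inv\<^bsub>Aut n\<^esub> \<tau> \<otimes>\<^bsub>Aut n\<^esub> \<phi> \<otimes>\<^bsub>Aut n\<^esub> \<tau>) [^]\<^bsub>Aut n\<^esub> d =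
    inv\<^bsub>Aut n\<^esub> \<tau> \<otimes>\<^bsub>Aut n\<^esub> \<phi> [^]\<^bsub>Aut n\<^esub> d \<otimes>\<^bsub>Aut n\<^esub> \<tau>" for d :: nat
    by (rule Aut.conj_nat_pow[OF \<tau> \<phi>(2)])
  have "abel_mat n (\<phi> [^]\<^bsub>Aut n\<^esub> d) = 1\<^sub>m n"
    if "abel_mat n (inv\<^bsub>Aut n\<^esub> \<tau> \<otimes>\<^bsub>Aut n\<^esub> \<phi> [^]\<^bsub>Aut n\<^esub> d \<otimes>\<^bsub>Aut n\<^esub> \<tau>) = 1\<^sub>m n" for d :: nat
  proof -
    let ?y = "inv\<^bsub>Aut n\<^esub> \<tau> \<otimes>\<^bsub>Aut n\<^esub> \<phi> [^]\<^bsub>Aut n\<^esub> d \<otimes>\<^bsub>Aut n\<^esub> \<tau>"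
    have y: "?y \<in> carrier (Aut n)" using \<tau> \<phi> by simp
    have cancel: "\<tau> \<otimes>\<^bsub>Aut n\<^esub> (inv\<^bsub>Aut n\<^esub> \<tau> \<otimes>\<^bsub>Aut n\<^esub> z) = z" if "z \<in> carrier (Aut n)" for z
      using \<tau> that by (simp add: Aut.m_assoc[symmetric])
    have "\<tau> \<otimes>\<^bsub>Aut n\<^esub> ?y \<otimes>\<^bsub>Aut n\<^esub> inv\<^bsub>Aut n\<^esub> \<tau> = \<phi> [^]\<^bsub>Aut n\<^esub> d"
      using \<tau> \<phi>(2) by (simp add: Aut.m_assoc cancel)
    then have "abel_mat n (\<phi> [^]\<^bsub>Aut n\<^esub> d) = abel_mat n \<tau> * abel_mat n ?y * abel_mat n (inv\<^bsub>Aut n\<^esub> \<tau>)"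
      using \<tau> y by (metis abel_mat_mult Aut.m_closed Aut.inv_closed)
    also have "\<dots> = abel_mat n (\<tau> \<otimes>\<^bsub>Aut n\<^esub> inv\<^bsub>Aut n\<^esub> \<tau>)"
      unfolding that using \<tau> abel_mat_mult[of \<tau> n "inv\<^bsub>Aut n\<^esub> \<tau>"]
      by (simp add: right_mult_one_mat[OF abel_mat_carrier])
    also have "\<dots> = 1\<^sub>m n" using \<tau> by (simp add: abel_mat_one)
    finally show ?thesis .
  qed
  moreover have "inv\<^bsub>Aut n\<^esub> \<tau> \<otimes>\<^bsub>Aut n\<^esub> \<phi> \<otimes>\<^bsub>Aut n\<^esub> \<tau> \<in> carrier (Aut_plus n)"
    using \<phi>(1) assms(2) subgroup.m_closed[OF subgroup_Aut_plus]
      subgroup.m_inv_closed[OF subgroup_Aut_plus] by blast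
  ultimately show ?thesis
    using assms(1) \<tau> by (auto simp: faithful_order_def pow)
qed

section \<open>From products of transvections to single transvections\<close>

text \<open>The left side is the commutator of \<open>inv c \<otimes> d\<close> and
  \<open>inv b \<otimes> a\<close>. As \<open>a\<close> commutes with \<open>c\<close> and
  \<open>d\<close>, it passes to its inverse and cancels; then \<open>d\<close> passes
  \<open>inv b\<close> and meets its inverse. What remains involves only \<open>b\<close> and
  \<open>c\<close>.\<close>

lemma (in group) commutator_cancel:
  assumes "a \<in> carrier G" "b \<in> carrier G" "c \<in> carrier G" "d \<in> carrier G"
    and ac: "a \<otimes> c = c \<otimes> a" and ad: "a \<otimes> d = d \<otimes> a" and bd: "b \<otimes> d = d \<otimes> b"
  shows "(inv c \<otimes> d) \<otimes> (inv b \<otimes> a) \<otimes> (inv d \<otimes> c) \<otimes> (inv a \<otimes> b) = inv c \<otimes> inv b \<otimes> c \<otimes> b"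
proof -
  have l: "x \<otimes> (inv x \<otimes> y) = y" "inv x \<otimes> (x \<otimes> y) = y" if "x \<in> carrier G" "y \<in> carrier G" for x y
    using that by (simp_all add: m_assoc[symmetric])
  have comm_inv: "x \<otimes> inv y = inv y \<otimes> x"
    if "x \<in> carrier G" "y \<in> carrier G" "x \<otimes> y = y \<otimes> x" for x y
    using that by (metis inv_closed inv_solve_left' inv_solve_right m_assoc m_closed)
  have db: "d \<otimes> inv b = inv b \<otimes> d" and da: "a \<otimes> inv d = inv d \<otimes> a"
    using assms by (simp_all add: comm_inv)
  have "a \<otimes> (inv d \<otimes> c) = (a \<otimes> inv d) \<otimes> c" using assms(1-4) by (simp add: m_assoc)
  also have "\<dots> = inv d \<otimes> c \<otimes> a" unfolding da using assms(1-4) ac by (simp add: m_assoc)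
  finally have "a \<otimes> (inv d \<otimes> c) = inv d \<otimes> c \<otimes> a" .
  then have "a \<otimes> (inv d \<otimes> c) \<otimes> inv a = inv d \<otimes> c"
    using assms by (simp add: m_assoc)
  moreover have "(inv c \<otimes> d) \<otimes> (inv b \<otimes> a) \<otimes> (inv d \<otimes> c) \<otimes> (inv a \<otimes> b) =
    inv c \<otimes> (d \<otimes> inv b) \<otimes> (a \<otimes> (inv d \<otimes> c) \<otimes> inv a) \<otimes> b"
    using assms(1-4) by (simp add: m_assoc)
  ultimately show ?thesis unfolding db using assms(1-4) by (simp add: m_assoc l)
qed

lemma (in group) conj_inv_mult:
  assumes "x \<in> carrier G" "a \<in> carrier G" "b \<in> carrier G" "a' \<in> carrier G" "b' \<in> carrier G"
    and "x \<otimes> a = a' \<otimes> x" "x \<otimes> b = b' \<otimes> x"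
  shows "x \<otimes> (inv a \<otimes> b) \<otimes> inv x = inv a' \<otimes> b'"
proof -
  have "x \<otimes> inv a = inv a' \<otimes> x"
    using assms(1-4,6) by (metis inv_closed inv_solve_left' inv_solve_right m_assoc m_closed)
  then have "x \<otimes> (inv a \<otimes> b) = inv a' \<otimes> b' \<otimes> x"
    using assms by (metis inv_closed m_assoc m_closed)
  then show ?thesis using assms by (simp add: m_assoc)
qed

section \<open>The generating set\<close>

context
  fixes n :: nat and H p c
  assumes H: "subgroup H (Aut n)" and p: "p permutes {..<n}" and c: "p c = c" "c < n"
    and mem: "special_perm n p c \<in> H"
begin

lemma special_perm_conj_transvection:
  assumes "i < n" "j < n" "i \<noteq> j" "i \<noteq> c" "j \<noteq> c"
  shows "special_perm n p c \<otimes>\<^bsub>Aut n\<^esub> transvection n b i j =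
    transvection n b (p i) (p j) \<otimes>\<^bsub>Aut n\<^esub> special_perm n p c"
  unfolding special_perm_def using signed_perm_transvection[OF p assms(1-3)] assms(4,5) by simp

text \<open>If i or j is the point \<open>c\<close>, the inverted generator may exchange the kinds
  or produce an inverse. Having both kinds in \<open>H\<close> absorbs this.\<close>

lemma transvections_in_subgroup_permute:
  assumes ij: "i < n" "j < n" "i \<noteq> j" and tv: "\<And>b. transvection n b i j \<in> H"
  shows "transvection n b (p i) (p j) \<in> H"
proof -
  let ?x = "special_perm n p c"
  define e where "e i \<longleftrightarrow> (i = c \<longrightarrow> evenperm p)" for i
  let ?b = "b = e i"
  let ?t = "transvection n b (p i) (p j)"
  have pij: "p i < n" "p j < n" "p i \<noteq> p j"
    using ij permutes_lessThan[OF p] permutes_inj[OF p] by (auto simp: inj_eq)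
  have x: "?x \<in> carrier (Aut n)" using mem subgroup.subset[OF H] by blast
  have b: "((b = e i) = e i) = b" by auto
  have "?x \<otimes>\<^bsub>Aut n\<^esub> transvection n ?b i j =
      (if e i = e j then ?t else inv\<^bsub>Aut n\<^esub> ?t) \<otimes>\<^bsub>Aut n\<^esub> ?x" (is "_ = ?t' \<otimes>\<^bsub>Aut n\<^esub> _")
    using signed_perm_transvection[OF p ij, of e ?b] unfolding b
    by (simp add: special_perm_def e_def[abs_def])
  then have "?t' = ?x \<otimes>\<^bsub>Aut n\<^esub> transvection n ?b i j \<otimes>\<^bsub>Aut n\<^esub> inv\<^bsub>Aut n\<^esub> ?x"
    using x ij pij by (simp add: Aut.m_assoc)
  also have "\<dots> \<in> H"
    using mem tv subgroup.m_closed[OF H] subgroup.m_inv_closed[OF H] by blast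
  finally have "?t' \<in> H" .
  then show ?thesis
    using subgroup.m_inv_closed[OF H, of "inv\<^bsub>Aut n\<^esub> ?t"] pij by (auto split: if_splits)
qed

lemma transvections_in_subgroup_funpow:
  assumes ij: "i < n" "j < n" "i \<noteq> j" and tv: "\<And>b. transvection n b i j \<in> H"
  shows "transvection n b ((p ^^ m) i) ((p ^^ m) j) \<in> H"
proof (induction m arbitrary: b)
  case (Suc m)
  have pm: "p ^^ m permutes {..<n}" using p by (rule permutes_funpow)
  have "(p ^^ m) i < n" "(p ^^ m) j < n" "(p ^^ m) i \<noteq> (p ^^ m) j"
    using ij permutes_lessThan[OF pm] permutes_inj[OF pm] by (auto simp: inj_eq)
  then show ?case using Suc transvections_in_subgroup_permute by simp
qed (simp add: tv)

text \<open>Only the points 0..4 are involved, and \<open>c\<close> lies beyond them. The sign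
  correction is therefore invisible, and each kind \<open>b\<close> can be treated by
  itself.\<close>

lemma transvections_1_3_and_1_4:
  assumes shift: "\<And>i. i < 4 \<Longrightarrow> p i = Suc i" and c4: "4 < c"
    and conj: "inv\<^bsub>Aut n\<^esub> transvection n b 0 1 \<otimes>\<^bsub>Aut n\<^esub> special_perm n p c \<otimes>\<^bsub>Aut n\<^esub> transvection n b 0 1 \<in> H"
  shows "transvection n b 1 3 \<in> H" and "transvection n b 1 4 \<in> H"
proof -
  let ?x = "special_perm n p c"
  let ?t = "transvection n b"
  note mult = subgroup.m_closed[OF H] and inv = subgroup.m_inv_closed[OF H]
  have n: "4 < n" using c4 c by simp
  have x: "?x \<in> carrier (Aut n)" using mem subgroup.subset[OF H] by blast
  have t: "?t i j \<in> carrier (Aut n)" if "i \<noteq> j" "i \<le> 4" "j \<le> 4" for i j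
    using that n by simp
  have shift_t: "?x \<otimes>\<^bsub>Aut n\<^esub> ?t i j = ?t (Suc i) (Suc j) \<otimes>\<^bsub>Aut n\<^esub> ?x"
    if "i \<noteq> j" "i < 4" "j < 4" for i j
    using special_perm_conj_transvection[of i j b] that n c4 shift by auto
  have step: "inv\<^bsub>Aut n\<^esub> ?t (Suc i) (Suc (Suc i)) \<otimes>\<^bsub>Aut n\<^esub> ?t (Suc (Suc i)) (Suc (Suc (Suc i))) \<in> H"
    if "inv\<^bsub>Aut n\<^esub> ?t i (Suc i) \<otimes>\<^bsub>Aut n\<^esub> ?t (Suc i) (Suc (Suc i)) \<in> H" "i < 2" for i
  proof -
    have "?x \<otimes>\<^bsub>Aut n\<^esub> (inv\<^bsub>Aut n\<^esub> ?t i (Suc i) \<otimes>\<^bsub>Aut n\<^esub> ?t (Suc i) (Suc (Suc i))) \<otimes>\<^bsub>Aut n\<^esub> inv\<^bsub>Aut n\<^esub> ?x =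
      inv\<^bsub>Aut n\<^esub> ?t (Suc i) (Suc (Suc i)) \<otimes>\<^bsub>Aut n\<^esub> ?t (Suc (Suc i)) (Suc (Suc (Suc i)))"
      by (rule Aut.conj_inv_mult) (use x t shift_t that(2) in auto)
    then show ?thesis using that(1) mem mult inv by metis
  qed
  have "inv\<^bsub>Aut n\<^esub> ?t 0 1 \<otimes>\<^bsub>Aut n\<^esub> ?x \<otimes>\<^bsub>Aut n\<^esub> ?t 0 1 \<otimes>\<^bsub>Aut n\<^esub> inv\<^bsub>Aut n\<^esub> ?x =
      inv\<^bsub>Aut n\<^esub> ?t 0 1 \<otimes>\<^bsub>Aut n\<^esub> (?t 1 2 \<otimes>\<^bsub>Aut n\<^esub> ?x) \<otimes>\<^bsub>Aut n\<^esub> inv\<^bsub>Aut n\<^esub> ?x"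
    using shift_t[of 0 1] x t[of 0 1] t[of 1 2] by (simp add: Aut.m_assoc numeral_2_eq_2)
  also have "\<dots> = inv\<^bsub>Aut n\<^esub> ?t 0 1 \<otimes>\<^bsub>Aut n\<^esub> ?t 1 2"
    using x t[of 0 1] t[of 1 2] by (simp add: Aut.m_assoc)
  finally have "inv\<^bsub>Aut n\<^esub> ?t 0 1 \<otimes>\<^bsub>Aut n\<^esub> ?t 1 2 \<in> H"
    using mult[OF conj inv[OF mem]] by simp
  then have ab: "inv\<^bsub>Aut n\<^esub> ?t 0 1 \<otimes>\<^bsub>Aut n\<^esub> ?t 1 2 \<in> H"
    and bc: "inv\<^bsub>Aut n\<^esub> ?t 1 2 \<otimes>\<^bsub>Aut n\<^esub> ?t 2 3 \<in> H"
    and cd: "inv\<^bsub>Aut n\<^esub> ?t 2 3 \<otimes>\<^bsub>Aut n\<^esub> ?t 3 4 \<in> H"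
    using step[of 0] step[of 1] by (simp_all add: numeral_eq_Suc)
  have flip: "inv\<^bsub>Aut n\<^esub> v \<otimes>\<^bsub>Aut n\<^esub> u \<in> H"
    if "inv\<^bsub>Aut n\<^esub> u \<otimes>\<^bsub>Aut n\<^esub> v \<in> H" "u \<in> carrier (Aut n)" "v \<in> carrier (Aut n)" for u v
    using inv[OF that(1)] that(2,3) by (simp add: Aut.inv_mult_group)
  have ba: "inv\<^bsub>Aut n\<^esub> ?t 1 2 \<otimes>\<^bsub>Aut n\<^esub> ?t 0 1 \<in> H"
    and dc: "inv\<^bsub>Aut n\<^esub> ?t 3 4 \<otimes>\<^bsub>Aut n\<^esub> ?t 2 3 \<in> H"
    using flip[OF ab] flip[OF cd] t by simp_all
  have tc: "?t i j \<otimes>\<^bsub>Aut n\<^esub> ?t i' j' = ?t i' j' \<otimes>\<^bsub>Aut n\<^esub> ?t i j"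
    if "i \<le> 4" "j \<le> 4" "i' \<le> 4" "j' \<le> 4" "i \<noteq> j" "i' \<noteq> j'" "i \<noteq> i'" "i \<noteq> j'" "i' \<noteq> j" for i j i' j'
    using that n by (intro transvection_commute) auto
  have commutator: "?t i l = inv\<^bsub>Aut n\<^esub> ?t j l \<otimes>\<^bsub>Aut n\<^esub> inv\<^bsub>Aut n\<^esub> ?t i j \<otimes>\<^bsub>Aut n\<^esub> ?t j l \<otimes>\<^bsub>Aut n\<^esub> ?t i j"
    if "i \<le> 4" "j \<le> 4" "l \<le> 4" "i \<noteq> j" "j \<noteq> l" "i \<noteq> l" for i j l
  proof -
    have "?t j l \<otimes>\<^bsub>Aut n\<^esub> ?t i j = ?t i j \<otimes>\<^bsub>Aut n\<^esub> ?t j l \<otimes>\<^bsub>Aut n\<^esub> ?t i l"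
      using that n by (intro transvection_commutator) auto
    then have "inv\<^bsub>Aut n\<^esub> (?t i j \<otimes>\<^bsub>Aut n\<^esub> ?t j l) \<otimes>\<^bsub>Aut n\<^esub> (?t j l \<otimes>\<^bsub>Aut n\<^esub> ?t i j) = ?t i l"
      using t[of i j] t[of j l] t[of i l] that
      by (metis Aut.inv_solve_left Aut.m_closed)
    then show ?thesis using t[of i j] t[of j l] that by (simp add: Aut.inv_mult_group Aut.m_assoc)
  qed
  have "?t 1 3 = inv\<^bsub>Aut n\<^esub> ?t 2 3 \<otimes>\<^bsub>Aut n\<^esub> inv\<^bsub>Aut n\<^esub> ?t 1 2 \<otimes>\<^bsub>Aut n\<^esub> ?t 2 3 \<otimes>\<^bsub>Aut n\<^esub> ?t 1 2"
    by (rule commutator) simp_all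
  also have "\<dots> = (inv\<^bsub>Aut n\<^esub> ?t 2 3 \<otimes>\<^bsub>Aut n\<^esub> ?t 3 4) \<otimes>\<^bsub>Aut n\<^esub> (inv\<^bsub>Aut n\<^esub> ?t 1 2 \<otimes>\<^bsub>Aut n\<^esub> ?t 0 1)
      \<otimes>\<^bsub>Aut n\<^esub> (inv\<^bsub>Aut n\<^esub> ?t 3 4 \<otimes>\<^bsub>Aut n\<^esub> ?t 2 3) \<otimes>\<^bsub>Aut n\<^esub> (inv\<^bsub>Aut n\<^esub> ?t 0 1 \<otimes>\<^bsub>Aut n\<^esub> ?t 1 2)"
    by (rule Aut.commutator_cancel[symmetric]) (simp_all add: t tc)
  also have "\<dots> \<in> H"
    by (rule mult[OF mult[OF mult[OF cd ba] dc] ab])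
  finally show t13: "?t 1 3 \<in> H" .
  have "?x \<otimes>\<^bsub>Aut n\<^esub> ?t 1 3 \<otimes>\<^bsub>Aut n\<^esub> inv\<^bsub>Aut n\<^esub> ?x = ?t 2 4"
    using shift_t[of 1 3] x t[of 2 4] by (simp add: Aut.m_assoc numeral_eq_Suc)
  then have t24: "?t 2 4 \<in> H" using t13 mem mult inv by metis
  \<comment> \<open>Since t(2,4) itself now lies in \<open>H\<close>, the cancellation is used with
    \<open>d\<close> equal to 1; it leaves the commutator of t(1,2) and t(2,4).\<close>
  have "inv\<^bsub>Aut n\<^esub> ?t 2 4 \<otimes>\<^bsub>Aut n\<^esub> (inv\<^bsub>Aut n\<^esub> ?t 1 2 \<otimes>\<^bsub>Aut n\<^esub> ?t 0 1) \<otimes>\<^bsub>Aut n\<^esub> ?t 2 4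
      \<otimes>\<^bsub>Aut n\<^esub> (inv\<^bsub>Aut n\<^esub> ?t 0 1 \<otimes>\<^bsub>Aut n\<^esub> ?t 1 2) \<in> H"
    by (rule mult[OF mult[OF mult[OF inv[OF t24] ba] t24] ab])
  also have "inv\<^bsub>Aut n\<^esub> ?t 2 4 \<otimes>\<^bsub>Aut n\<^esub> (inv\<^bsub>Aut n\<^esub> ?t 1 2 \<otimes>\<^bsub>Aut n\<^esub> ?t 0 1) \<otimes>\<^bsub>Aut n\<^esub> ?t 2 4
      \<otimes>\<^bsub>Aut n\<^esub> (inv\<^bsub>Aut n\<^esub> ?t 0 1 \<otimes>\<^bsub>Aut n\<^esub> ?t 1 2) = ?t 1 4"
    using Aut.commutator_cancel[of "?t 0 1" n "?t 1 2" "?t 2 4" "\<one>\<^bsub>Aut n\<^esub>"] tc[of 0 1 2 4] t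
      commutator[of 1 2 4] by simp
  finally show "?t 1 4 \<in> H" .
qed

end

text \<open>With \<open>q = (n - 1) div k\<close> one has n - k \<le> q k \<le> n - 1. The upper
  bound leaves n - 1 fixed by \<open>\<rho>\<^sub>1\<close> and 0 fixed by
  \<open>\<rho>\<^sub>2\<close>, as places for the sign corrections; the lower bound says that the
  last k points cover everything from q k on. They do not contain 0, since k < n. The bounds are
  spelled \<open>0 + q * k\<close> and \<open>1 * k\<close> to keep the shape of
  \<open>block_rotation_funpow\<close>.\<close>

context
  fixes k n q :: nat and \<rho>\<^sub>1 \<rho>\<^sub>2 \<rho>\<^sub>3 :: "nat \<Rightarrow> nat"
    and \<sigma>\<^sub>1 \<sigma>\<^sub>2 \<sigma>\<^sub>3 :: "(nat \<times> bool) list \<Rightarrow> (nat \<times> bool) list"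
    and \<theta> :: "bool \<Rightarrow> (nat \<times> bool) list \<Rightarrow> (nat \<times> bool) list"
  assumes k: "5 \<le> k" and n: "k < n"
  defines "q \<equiv> (n - 1) div k"
    and "\<rho>\<^sub>1 \<equiv> block_rotation k 0 (0 + q * k)"
    and "\<rho>\<^sub>2 \<equiv> block_rotation k 1 (1 + q * k)"
    and "\<rho>\<^sub>3 \<equiv> block_rotation k (n - k) (n - k + 1 * k)"
    and "\<sigma>\<^sub>1 \<equiv> special_perm n \<rho>\<^sub>1 (n - 1)"
    and "\<sigma>\<^sub>2 \<equiv> special_perm n \<rho>\<^sub>2 0"
    and "\<sigma>\<^sub>3 \<equiv> special_perm n \<rho>\<^sub>3 0"
    and "\<theta> \<equiv> \<lambda>b. inv\<^bsub>Aut n\<^esub> transvection n b 0 1 \<otimes>\<^bsub>Aut n\<^esub> \<sigma>\<^sub>1 \<otimes>\<^bsub>Aut n\<^esub> transvection n b 0 1"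
begin

private lemma q: "k \<le> q * k" "q * k \<le> n - 1" "n - k \<le> q * k"
proof -
  have "0 < q" using n k unfolding q_def by (simp add: div_greater_zero_iff)
  then show "k \<le> q * k" by simp
  show "q * k \<le> n - 1" by (simp add: q_def)
  have "n - 1 < q * k + k" using k dividend_less_div_times[of k "n - 1"] by (simp add: q_def)
  then show "n - k \<le> q * k" using n by simp
qed

private lemma permutes:
  "\<rho>\<^sub>1 permutes {..<n}" "\<rho>\<^sub>2 permutes {..<n}" "\<rho>\<^sub>3 permutes {..<n}"
  unfolding \<rho>\<^sub>1_def \<rho>\<^sub>2_def \<rho>\<^sub>3_def
  by (rule block_rotation_permutes; use k n q in simp)+

private lemma fixed: "\<rho>\<^sub>1 (n - 1) = n - 1" "\<rho>\<^sub>2 0 = 0" "\<rho>\<^sub>3 0 = 0"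
  unfolding \<rho>\<^sub>1_def \<rho>\<^sub>2_def \<rho>\<^sub>3_def using n q by (simp_all add: block_rotation_outside)

private lemma faithful_orders:
  "faithful_order n k \<sigma>\<^sub>1" "faithful_order n k \<sigma>\<^sub>2" "faithful_order n k \<sigma>\<^sub>3" "faithful_order n k (\<theta> b)"
proof -
  have moved: "(block_rotation k a (a + r * k) ^^ d) a \<noteq> a" if "k \<le> r * k" "0 < d" "d < k" for a r d
    using block_rotation_funpow[of a a r k d] that k by simp
  show 1: "faithful_order n k \<sigma>\<^sub>1"
    unfolding \<sigma>\<^sub>1_def
    by (rule special_perm_faithful_order[OF permutes(1) fixed(1), of k 0])
      (use n k q moved[of q _ 0] block_rotation_funpow_period[of k 0 q] in \<open>auto simp: \<rho>\<^sub>1_def\<close>)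
  show "faithful_order n k \<sigma>\<^sub>2"
    unfolding \<sigma>\<^sub>2_def
    by (rule special_perm_faithful_order[OF permutes(2) fixed(2), of k 1])
      (use n k q moved[of q _ 1] block_rotation_funpow_period[of k 1 q] in \<open>auto simp: \<rho>\<^sub>2_def\<close>)
  show "faithful_order n k \<sigma>\<^sub>3"
    unfolding \<sigma>\<^sub>3_def
    by (rule special_perm_faithful_order[OF permutes(3) fixed(3), of k "n - k"])
      (use n k q moved[of 1 _ "n - k"] block_rotation_funpow_period[of k "n - k" 1] in \<open>auto simp: \<rho>\<^sub>3_def\<close>)
  show "faithful_order n k (\<theta> b)"
    unfolding \<theta>_def using 1 n k by (intro faithful_order_conj) auto
qed

section \<open>Linked generators\<close>

context
  fixes H
  assumes H: "subgroup H (Aut n)" and mem: "\<sigma>\<^sub>1 \<in> H" "\<sigma>\<^sub>2 \<in> H" "\<sigma>\<^sub>3 \<in> H" "\<And>b. \<theta> b \<in> H"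
begin

text \<open>Counting \<open>i = j\<close> as linked makes transitivity hold without exceptions. Both
  kinds are required so that the corrected rotations preserve the relation.\<close>

private definition linked :: "nat \<Rightarrow> nat \<Rightarrow> bool" where
  "linked i j \<longleftrightarrow> i = j \<or> (\<forall>b. transvection n b i j \<in> H)"

private lemma linked_trans:
  assumes "linked i j" "linked j l" "i < n" "j < n" "l < n"
  shows "linked i l"
proof (cases "i = j \<or> j = l \<or> i = l")
  case False
  have "transvection n b i l \<in> H" for b
  proof -
    let ?s = "transvection n b i j" and ?t = "transvection n b j l" and ?u = "transvection n b i l"
    have st: "?s \<in> H" "?t \<in> H" using False assms by (auto simp: linked_def)
    have "?t \<otimes>\<^bsub>Aut n\<^esub> ?s = ?s \<otimes>\<^bsub>Aut n\<^esub> ?t \<otimes>\<^bsub>Aut n\<^esub> ?u"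
      using False assms by (intro transvection_commutator) auto
    then have "?u = inv\<^bsub>Aut n\<^esub> (?s \<otimes>\<^bsub>Aut n\<^esub> ?t) \<otimes>\<^bsub>Aut n\<^esub> (?t \<otimes>\<^bsub>Aut n\<^esub> ?s)"
      using False assms by (intro Aut.inv_solve_left[THEN iffD2]) auto
    also have "\<dots> \<in> H"
      using st subgroup.m_closed[OF H] subgroup.m_inv_closed[OF H] by blast
    finally show ?thesis .
  qed
  then show ?thesis by (simp add: linked_def)
qed (use assms in \<open>auto simp: linked_def\<close>)

private lemma linked_permute:
  assumes "linked i j" "i < n" "j < n"
  shows "linked (\<rho>\<^sub>1 i) (\<rho>\<^sub>1 j)" "linked (\<rho>\<^sub>2 i) (\<rho>\<^sub>2 j)" "linked (\<rho>\<^sub>3 i) (\<rho>\<^sub>3 j)"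
proof -
  have c: "n - 1 < n" "0 < n" using n by auto
  show "linked (\<rho>\<^sub>1 i) (\<rho>\<^sub>1 j)" "linked (\<rho>\<^sub>2 i) (\<rho>\<^sub>2 j)" "linked (\<rho>\<^sub>3 i) (\<rho>\<^sub>3 j)"
    using transvections_in_subgroup_permute[OF H permutes(1) fixed(1) c(1) mem(1)[unfolded \<sigma>\<^sub>1_def], of i j]
      transvections_in_subgroup_permute[OF H permutes(2) fixed(2) c(2) mem(2)[unfolded \<sigma>\<^sub>2_def], of i j]
      transvections_in_subgroup_permute[OF H permutes(3) fixed(3) c(2) mem(3)[unfolded \<sigma>\<^sub>3_def], of i j]
      assms unfolding linked_def by blast+
qed

private lemma \<rho>\<^sub>1_pow: "i < k \<Longrightarrow> (\<rho>\<^sub>1 ^^ m) i = (i + m) mod k"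
  using block_rotation_funpow[of 0 i q k m] q by (simp add: \<rho>\<^sub>1_def)

private lemma linked_shift: "linked (m mod k) ((m + 2) mod k)" "linked (m mod k) ((m + 3) mod k)"
proof -
  have c: "n - 1 < n" "4 < n - 1" using n k by auto
  have shift: "\<rho>\<^sub>1 i = Suc i" if "i < 4" for i
  proof -
    have "i < 0 + q * k" using that k q(1) by linarith
    then show ?thesis unfolding \<rho>\<^sub>1_def using that k by (intro block_rotation_Suc) auto
  qed
  have 13: "transvection n b 1 3 \<in> H" "transvection n b 1 4 \<in> H" for b
    using transvections_1_3_and_1_4[OF H permutes(1) fixed(1) c(1) mem(1)[unfolded \<sigma>\<^sub>1_def] shift c(2)]
      mem(4)[of b, unfolded \<theta>_def \<sigma>\<^sub>1_def] by auto
  note pow = transvections_in_subgroup_funpow[OF H permutes(1) fixed(1) c(1) mem(1)[unfolded \<sigma>\<^sub>1_def]]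
  \<comment> \<open>The power m + (k - 1) of the rotation carries 1, 3 and 4 to the residues of m, m
    + 2 and m + 3; adding k - 1 stands in for subtracting 1.\<close>
  have "1 + (m + (k - 1)) = m + k" "3 + (m + (k - 1)) = m + 2 + k" "4 + (m + (k - 1)) = m + 3 + k"
    using k by simp_all
  then have "(1 + (m + (k - 1))) mod k = m mod k" "(3 + (m + (k - 1))) mod k = (m + 2) mod k"
    "(4 + (m + (k - 1))) mod k = (m + 3) mod k"
    by (simp_all only: mod_add_self2)
  then show "linked (m mod k) ((m + 2) mod k)" "linked (m mod k) ((m + 3) mod k)"
    using pow[of 1 3 _ "m + (k - 1)"] pow[of 1 4 _ "m + (k - 1)"] 13 k n
    by (auto simp: linked_def \<rho>\<^sub>1_pow)
qed

text \<open>The induction carries two consecutive targets, starting with the distances 2 and 3. The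
  next target is the older of the two moved on by 2, so every distance from 2 on is reached.\<close>

private lemma linked_first_block:
  assumes "i < k" "j < k"
  shows "linked i j"
proof -
  have less: "a mod k < n" for a using mod_less_divisor[of k a] k n by linarith
  have "linked (i mod k) ((i + s + 2) mod k) \<and> linked (i mod k) ((i + Suc s + 2) mod k)" for s
  proof (induction s)
    case 0
    then show ?case using linked_shift[of i] by (simp add: numeral_eq_Suc)
  next
    case (Suc s)
    have "linked (i mod k) ((i + s + 2 + 2) mod k)"
      using linked_trans[OF _ linked_shift(1)] Suc less by blast
    then show ?case using Suc by (simp add: numeral_eq_Suc)
  qed
  \<comment> \<open>The distance j - i is raised by two full turns so that no subtraction is
    truncated.\<close>
  moreover have "i + (k + j - i + k - 2) + 2 = j + k + k" using assms k by simp
  ultimately have "linked (i mod k) ((j + k + k) mod k)" by metis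
  then show ?thesis using assms by simp
qed

text \<open>Each step from i to i + 1 uses a rotation that maps i to i + 1. At the end of a block
  and in the tail this rotation fixes 0; inside a block \<open>\<rho>\<^sub>1\<close> moves 0 to 1,
  and the links between 0 and 1 in the first block bring it back.\<close>

private lemma linked_all:
  assumes "i < n"
  shows "linked 0 i \<and> linked i 0"
  using assms
proof (induction i)
  case (Suc i)
  then have IH: "linked 0 i" "linked i 0" and i: "i < n" "0 < n" by auto
  consider "i < q * k" "Suc (i mod k) \<noteq> k" | "i < q * k" "Suc (i mod k) = k" | "q * k \<le> i"
    by linarith
  then show ?case
  proof cases
    case 2
    have "i \<noteq> 0" using 2 k by (cases i) auto
    then obtain l where l: "i = Suc l" using not0_implies_Suc by blast
    \<comment> \<open>A last position in the blocks counted from 0 is the last but one in the blocks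
      counted from 1.\<close>
    have "Suc (l mod k) \<noteq> k"
      using 2 k unfolding l by (auto simp: mod_Suc split: if_splits)
    then have "\<rho>\<^sub>2 i = Suc i"
      unfolding \<rho>\<^sub>2_def using 2 l by (intro block_rotation_Suc) auto
    then show ?thesis using linked_permute(2)[OF IH(1) i(2,1)] linked_permute(2)[OF IH(2) i]
      by (simp add: fixed)
  next
    case 3
    have "i - (n - k) < k" "Suc (i - (n - k)) < k" using 3 q n Suc.prems by auto
    then have "\<rho>\<^sub>3 i = Suc i"
      unfolding \<rho>\<^sub>3_def using 3 q Suc.prems n by (intro block_rotation_Suc) auto
    then show ?thesis using linked_permute(3)[OF IH(1) i(2,1)] linked_permute(3)[OF IH(2) i]
      by (simp add: fixed)
  next
    case 1
    have "\<rho>\<^sub>1 i = Suc i" unfolding \<rho>\<^sub>1_def using 1 by (intro block_rotation_Suc) auto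
    moreover have "\<rho>\<^sub>1 0 = 1"
    proof -
      have "0 < 0 + q * k" using k q(1) by linarith
    then show ?thesis unfolding \<rho>\<^sub>1_def using k by (subst block_rotation_Suc) auto
  qed
    ultimately have "linked 1 (Suc i)" "linked (Suc i) 1"
      using linked_permute(1)[OF IH(1) i(2,1)] linked_permute(1)[OF IH(2) i] by auto
    moreover have "linked 0 1" "linked 1 0" using linked_first_block k by auto
    moreover have "1 < n" using k n by simp
    ultimately show ?thesis
      using linked_trans[of 0 1 "Suc i"] linked_trans[of "Suc i" 1 0] Suc.prems i(2) by blast
  qed
qed (simp add: linked_def)

lemma Aut_plus_subset_if_generators: "carrier (Aut_plus n) \<subseteq> H"
proof (rule Aut_plus_subset_transvection_subgroup[OF H])
  fix b i j assume ij: "i < n" "j < n" "i \<noteq> j"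
  have "linked i j" using linked_trans[of i 0 j] linked_all[of i] linked_all[of j] ij by auto
  then show "transvection n b i j \<in> H" using ij by (simp add: linked_def)
qed

end

lemma Aut_plus_generators:
  obtains A where "finite A" "card A \<le> 5" "\<And>\<phi>. \<phi> \<in> A \<Longrightarrow> faithful_order n k \<phi>"
    "generate (Aut_plus n) A = carrier (Aut_plus n)"
proof
  let ?A = "{\<sigma>\<^sub>1, \<sigma>\<^sub>2, \<sigma>\<^sub>3, \<theta> True, \<theta> False}"
  show fo: "faithful_order n k \<phi>" if "\<phi> \<in> ?A" for \<phi> using that faithful_orders by auto
  then have A: "?A \<subseteq> carrier (Aut_plus n)" by (auto simp: faithful_order_def)
  then have AA: "?A \<subseteq> carrier (Aut n)" using Aut_plus_carrierD by blast
  show "card ?A \<le> 5" by (simp add: card_insert_if)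
  have "generate (Aut_plus n) ?A = generate (Aut n) ?A"
    using Aut.generate_consistent[OF A subgroup_Aut_plus] by (simp add: Aut_plus_def)
  moreover have "generate (Aut n) ?A \<subseteq> carrier (Aut_plus n)"
    by (rule Aut.generate_subgroup_incl[OF A subgroup_Aut_plus])
  moreover have "carrier (Aut_plus n) \<subseteq> generate (Aut n) ?A"
  proof (rule Aut_plus_subset_if_generators[OF Aut.generate_is_subgroup[OF AA]])
    show "\<theta> b \<in> generate (Aut n) ?A" for b by (cases b) (auto intro: generate.incl)
  qed (auto intro: generate.incl)
  ultimately show "generate (Aut_plus n) ?A = carrier (Aut_plus n)" by blast
qed simp

end

section \<open>Passing to quotients\<close>

text \<open>The order of an image divides \<open>k\<close>, which also excludes the value 0 for
  infinite order, and it cannot be smaller than \<open>k\<close>. The map may identify generators,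
  which only lowers their number.\<close>

lemma generated_by_elements_of_order_image:
  assumes "group_hom G K h" "h ` carrier G = carrier K"
    and A: "finite A" "card A \<le> m" "A \<subseteq> carrier G" "generate G A = carrier G" and k: "k > 0"
    and "\<And>a. a \<in> A \<Longrightarrow> a [^]\<^bsub>G\<^esub> k = \<one>\<^bsub>G\<^esub>"
    and "\<And>a d. a \<in> A \<Longrightarrow> 0 < d \<Longrightarrow> d < k \<Longrightarrow> h (a [^]\<^bsub>G\<^esub> d) \<noteq> \<one>\<^bsub>K\<^esub>"
  shows "generated_by_elements_of_order K m k"
proof -
  interpret h: group_hom G K h by fact
  have ord: "h.H.ord (h a) = k" if a: "a \<in> A" for a
  proof -
    have aG: "a \<in> carrier G" using a A by blast
    have "h a [^]\<^bsub>K\<^esub> k = \<one>\<^bsub>K\<^esub>"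
      using h.hom_nat_pow[OF aG, of k] assms(8)[OF a] by simp
    then have dvd: "h.H.ord (h a) dvd k" using aG by (simp add: h.H.pow_eq_id)
    then have pos: "0 < h.H.ord (h a)" and le: "h.H.ord (h a) \<le> k"
      using k by (auto intro: dvd_imp_le dvd_pos_nat)
    have "h (a [^]\<^bsub>G\<^esub> h.H.ord (h a)) = \<one>\<^bsub>K\<^esub>"
      using h.hom_nat_pow[OF aG] aG by simp
    then show ?thesis using assms(9)[OF a pos] le by linarith
  qed
  show ?thesis
    unfolding generated_by_elements_of_order_def
  proof (intro exI[of _ "h ` A"] conjI ballI)
    show "h ` A \<subseteq> carrier K" using A by auto
    show "card (h ` A) \<le> m" using card_image_le[OF A(1), of h] A(2) by linarith
    show "generate K (h ` A) = carrier K"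
      using h.generate_img[OF A(3)] assms(2) A(4) by simp
  qed (use ord A in auto)
qed

section \<open>The projections of the special automorphism group\<close>

lemma Aut_plus_pow [simp]: "a [^]\<^bsub>Aut_plus n\<^esub> (d::nat) = a [^]\<^bsub>Aut n\<^esub> d"
  unfolding Aut_plus_def by (rule Aut.nat_pow_consistent[symmetric])

lemma Aut_plus_mult [simp]: "monoid.mult (Aut_plus n) = monoid.mult (Aut n)"
  and Aut_plus_one [simp]: "\<one>\<^bsub>Aut_plus n\<^esub> = \<one>\<^bsub>Aut n\<^esub>"
  by (simp_all add: Aut_plus_def)

lemma abel_mat_group_hom: "group_hom (Aut_plus n) (SL n) (abel_mat n)"
proof -
  have "abel_mat n \<in> hom (Aut_plus n) (SL n)"
    by (rule homI) (auto simp: Aut_plus_iff SL_def abel_mat_mult)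
  then show ?thesis
    by (simp add: group_hom_def group_hom_axioms_def group_Aut_plus group_SL)
qed

lemma Out_proj_group_hom:
  "group_hom (Aut n) (Out n) (\<lambda>\<phi>. Inn (Fn n) #>\<^bsub>Aut n\<^esub> \<phi>)"
  using normal.r_coset_hom_Mod[OF Inn_normal, of n] group_Out[of n]
  by (simp add: group_hom_def group_hom_axioms_def group_Aut Out_def)

text \<open>The abelianized matrix is constant on cosets of the inner automorphisms, so the
  determinant condition can be read off from any representative.\<close>

lemma Out_plus_carrier:
  "carrier (Out_plus n) = (\<lambda>\<phi>. Inn (Fn n) #>\<^bsub>Aut n\<^esub> \<phi>) ` carrier (Aut_plus n)"
proof -
  have "the_elem (abel_mat n ` (Inn (Fn n) #>\<^bsub>Aut n\<^esub> \<phi>)) = abel_mat n \<phi>"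
    if \<phi>: "\<phi> \<in> carrier (Aut n)" for \<phi>
  proof -
    have "Inn (Fn n) #>\<^bsub>Aut n\<^esub> \<phi> \<in> carrier (Out n)"
      using group_hom.hom_closed[OF Out_proj_group_hom \<phi>] .
    moreover have "\<phi> \<in> Inn (Fn n) #>\<^bsub>Aut n\<^esub> \<phi>"
      by (rule Aut.rcos_self[OF \<phi> normal_imp_subgroup[OF Inn_normal]])
    ultimately show ?thesis using abel_mat_coset by (metis the_elem_eq)
  qed
  moreover have "carrier (Out n) = (\<lambda>\<phi>. Inn (Fn n) #>\<^bsub>Aut n\<^esub> \<phi>) ` carrier (Aut n)"
    by (auto simp: Out_def FactGroup_def RCOSETS_def)
  ultimately show ?thesis by (auto simp: Out_plus_def Aut_plus_def)
qed

lemma Out_plus_proj_group_hom: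
  "group_hom (Aut_plus n) (Out_plus n) (\<lambda>\<phi>. Inn (Fn n) #>\<^bsub>Aut n\<^esub> \<phi>)"
proof -
  interpret \<pi>: group_hom "Aut n" "Out n" "\<lambda>\<phi>. Inn (Fn n) #>\<^bsub>Aut n\<^esub> \<phi>" by (rule Out_proj_group_hom)
  have "subgroup (carrier (Out_plus n)) (Out n)"
    unfolding Out_plus_carrier by (rule \<pi>.subgroup_img_is_subgroup[OF subgroup_Aut_plus])
  then have "group (Out_plus n)"
    using group.subgroup_imp_group[OF group_Out] by (simp add: Out_plus_def)
  moreover have "(\<lambda>\<phi>. Inn (Fn n) #>\<^bsub>Aut n\<^esub> \<phi>) \<in> hom (Aut_plus n) (Out_plus n)"
  proof (rule homI)
    fix \<phi> \<psi> assume "\<phi> \<in> carrier (Aut_plus n)" "\<psi> \<in> carrier (Aut_plus n)"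
    then show "Inn (Fn n) #>\<^bsub>Aut n\<^esub> (\<phi> \<otimes>\<^bsub>Aut_plus n\<^esub> \<psi>) =
      (Inn (Fn n) #>\<^bsub>Aut n\<^esub> \<phi>) \<otimes>\<^bsub>Out_plus n\<^esub> (Inn (Fn n) #>\<^bsub>Aut n\<^esub> \<psi>)"
      using \<pi>.hom_mult by (simp add: Aut_plus_carrierD Out_plus_def)
  qed (simp add: Out_plus_carrier)
  ultimately show ?thesis
    by (simp add: group_hom_def group_hom_axioms_def group_Aut_plus)
qed

lemma generated_by_five_elements:
  assumes "5 \<le> k" "k < n" "5 \<le> m"
  shows "generated_by_elements_of_order (Aut_plus n) m k"
    and "generated_by_elements_of_order (Out_plus n) m k"
    and "generated_by_elements_of_order (SL n) m k"
proof -
  obtain A where A: "finite A" "card A \<le> 5" and fo: "\<And>\<phi>. \<phi> \<in> A \<Longrightarrow> faithful_order n k \<phi>"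
    and gen: "generate (Aut_plus n) A = carrier (Aut_plus n)"
    using Aut_plus_generators[OF assms(1,2)] by blast
  have m: "card A \<le> m" and k: "k > 0" using A(2) assms by auto
  have sub: "A \<subseteq> carrier (Aut_plus n)" using fo by (auto simp: faithful_order_def)
  have pow: "a [^]\<^bsub>Aut_plus n\<^esub> k = \<one>\<^bsub>Aut_plus n\<^esub>" if "a \<in> A" for a
    using fo[OF that] by (simp add: faithful_order_def)
  have ne: "abel_mat n (a [^]\<^bsub>Aut_plus n\<^esub> d) \<noteq> 1\<^sub>m n" if "a \<in> A" "0 < d" "d < k" for a d
    using fo[OF that(1)] that(2,3) by (simp add: faithful_order_def)
  show "generated_by_elements_of_order (SL n) m k"
    by (rule generated_by_elements_of_order_image[OF abel_mat_group_hom abel_mat_surj A(1) m sub gen k pow])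
      (use ne in \<open>auto simp: SL_def\<close>)
  have "group_hom (Aut_plus n) (Aut_plus n) (\<lambda>\<phi>. \<phi>)"
    by (simp add: group_hom_def group_hom_axioms_def group_Aut_plus hom_def)
  then show "generated_by_elements_of_order (Aut_plus n) m k"
  proof (rule generated_by_elements_of_order_image[OF _ _ A(1) m sub gen k pow])
    show "a [^]\<^bsub>Aut_plus n\<^esub> d \<noteq> \<one>\<^bsub>Aut_plus n\<^esub>" if "a \<in> A" "0 < d" "d < k" for a and d :: nat
      using ne[OF that] abel_mat_one[of n] by auto
  qed auto
  show "generated_by_elements_of_order (Out_plus n) m k"
  proof (rule generated_by_elements_of_order_image[OF Out_plus_proj_group_hom Out_plus_carrier[symmetric]
        A(1) m sub gen k pow])
    fix a and d :: nat assume a: "a \<in> A" and d: "0 < d" "d < k"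
    have c: "a [^]\<^bsub>Aut n\<^esub> d \<in> carrier (Aut n)"
      using sub a Aut_plus_carrierD by (intro Aut.nat_pow_closed) blast
    show "Inn (Fn n) #>\<^bsub>Aut n\<^esub> (a [^]\<^bsub>Aut_plus n\<^esub> d) \<noteq> \<one>\<^bsub>Out_plus n\<^esub>"
    proof
      assume "Inn (Fn n) #>\<^bsub>Aut n\<^esub> (a [^]\<^bsub>Aut_plus n\<^esub> d) = \<one>\<^bsub>Out_plus n\<^esub>"
      then have "Inn (Fn n) #>\<^bsub>Aut n\<^esub> (a [^]\<^bsub>Aut n\<^esub> d) = Inn (Fn n)"
        by (simp add: Out_plus_def Out_def)
      \<comment> \<open>A power that is trivial in the outer group is inner, so it acts trivially on
        the abelianization, against the faithful order.\<close>
      then have "a [^]\<^bsub>Aut n\<^esub> d \<in> Inn (Fn n)"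
        using Aut.rcos_self[OF c normal_imp_subgroup[OF Inn_normal]] by simp
      then show False using abel_mat_Inn ne[OF a d] by simp
    qed
  qed
qed

theorem theorem1p3:
  fixes k n :: nat
  assumes "k \<ge> 5" and "n \<ge> 2 * (k - 1)"
  shows "(generated_by_elements_of_order (Aut_plus n) 8 k \<and>
          generated_by_elements_of_order (Out_plus n) 8 k \<and>
          generated_by_elements_of_order (SL n) 8 k) \<and>
         (k \<ge> 6 \<and> n \<ge> 2 * k \<longrightarrow>
          generated_by_elements_of_order (Aut_plus n) 7 k \<and>
          generated_by_elements_of_order (Out_plus n) 7 k \<and>
          generated_by_elements_of_order (SL n) 7 k)"
proof -
  \<comment> \<open>2(k - 1) = k + (k - 2) exceeds k, and a generating set of at most five elements
    meets both bounds on the number of elements.\<close>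
  have "k < n" using assms by simp
  then show ?thesis using generated_by_five_elements[OF assms(1)] by simp
qed

end
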